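(* Let $K$ be a field, let $m$ be a positive integer, let $V$ be an $m$-dimensional vector space over $K$, and let $n>m$ be an integer. Then there exists a non-zero polynomial $f\in K[V^n]$ such that every $n$-point configuration $(P_1,\ldots,P_n)\in V^n$ with $f(P_1,\ldots,P_n)\ne 0$ is reconstructible from volumes.
   Context: Identify $V$ with $K^m$ (column vectors) by a choice of basis. $V^n$ is the direct sum of $n$ copies of $V$; an $n$-point configuration is an element of $V^n$. $K[V^n]$ is the ring of polynomials on $V^n$, i.e. the polynomial ring $K[x_{i,k}: 1\le i\le n,\ 1\le k\le m]$, where $x_{i,k}$ stands for the $k$-th coordinate of the $i$-th point. For $P_1,\ldots,P_n\in K^m$ and indices $1\le i_0<\cdots<i_m\le n$ put $a_{i_0,\ldots,i_m}=\det(P_{i_1}-P_{i_0},\ldots,P_{i_m}-P_{i_0})$, and let $$V_{P_1,\ldots,P_n}(X)=\prod_{1\le i_0<\cdots<i_m\le n}\left(X-a_{i_0,\ldots,i_m}^2\right)\in K[X].$$ A configuration $(P_1,\ldots,P_n)$ is called reconstructible from volumes if for every $n$-point configuration $(Q_1,\ldots,Q_n)$ with $V_{Q_1,\ldots,Q_n}(X)=V_{P_1,\ldots,P_n}(X)$ there exist a permutation $\pi\in S_n$, a linear map $\phi\in\mathrm{GL}_m(K)$ with $\det(\phi)=\pm1$, and a vector $v\in K^m$ such that $Q_i=\phi(P_{\pi(i)}+v)$ for all $i=1,\ldots,n$. *)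

theory Defs
  imports
    "HOL-Library.Poly_Mapping"
    "HOL-Computational_Algebra.Polynomial"
    "HOL-Combinatorics.Permutations"
    "Jordan_Normal_Form.Determinant"
begin

text \<open>
  The space \<open>V = K\<^sup>m\<close> is \<^term>\<open>carrier_vec m\<close> over a type of class \<^class>\<open>field\<close>. Points and
  coordinates are numbered from 0, so the points of an \<open>n\<close>-point configuration are
  \<open>P 0, \<dots>, P (n - 1)\<close>; values of \<open>P\<close> at indices \<open>\<ge> n\<close> are irrelevant.
\<close>

definition configurations :: "nat \<Rightarrow> nat \<Rightarrow> (nat \<Rightarrow> 'a vec) set" where
  "configurations m n = {..<n} \<rightarrow> carrier_vec m"

text \<open>
  Formal polynomials in variables \<open>x\<^bsub>i,k\<^esub>\<close>, named by pairs \<open>(i, k)\<close>: finitely supported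
  maps from monomials (finitely supported exponent maps) to coefficients. Over a finite field a
  nonzero formal polynomial may vanish at every configuration, so \<open>K[V\<^sup>n]\<close> must not be rendered
  as a set of functions.
\<close>

type_synonym 'a config_poly = "((nat \<times> nat) \<Rightarrow>\<^sub>0 nat) \<Rightarrow>\<^sub>0 'a"

definition config_poly_ring :: "nat \<Rightarrow> nat \<Rightarrow> 'a::zero config_poly set" where
  "config_poly_ring m n =
     {f. \<forall>t \<in> Poly_Mapping.keys f. Poly_Mapping.keys t \<subseteq> {..<n} \<times> {..<m}}"

definition config_poly_eval :: "'a::comm_semiring_1 config_poly \<Rightarrow> (nat \<Rightarrow> 'a vec) \<Rightarrow> 'a" where
  "config_poly_eval f P =
     (\<Sum>t \<in> Poly_Mapping.keys f. Poly_Mapping.lookup f t *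
        (\<Prod>(i, k) \<in> Poly_Mapping.keys t. (P i $ k) ^ Poly_Mapping.lookup t (i, k)))"

definition index_tuples :: "nat \<Rightarrow> nat \<Rightarrow> nat list set" where
  "index_tuples m n = {is. length is = m + 1 \<and> sorted_wrt (<) is \<and> set is \<subseteq> {..<n}}"

definition simplex_volume :: "nat \<Rightarrow> (nat \<Rightarrow> 'a::comm_ring_1 vec) \<Rightarrow> nat list \<Rightarrow> 'a" where
  "simplex_volume m P is = det (mat_of_cols m (map (\<lambda>i. P i - P (hd is)) (tl is)))"

definition volume_poly :: "nat \<Rightarrow> nat \<Rightarrow> (nat \<Rightarrow> 'a::comm_ring_1 vec) \<Rightarrow> 'a poly" where
  "volume_poly m n P = (\<Prod>is \<in> index_tuples m n. [:- ((simplex_volume m P is)\<^sup>2), 1:])"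

definition reconstructible_from_volumes :: "nat \<Rightarrow> nat \<Rightarrow> (nat \<Rightarrow> 'a::field vec) \<Rightarrow> bool" where
  "reconstructible_from_volumes m n P \<longleftrightarrow>
     (\<forall>Q \<in> configurations m n. volume_poly m n Q = volume_poly m n P \<longrightarrow>
        (\<exists>\<pi> A v. \<pi> permutes {..<n} \<and>
           A \<in> carrier_mat m m \<and> invertible_mat A \<and> (det A = 1 \<or> det A = - 1) \<and>
           v \<in> carrier_vec m \<and>
           (\<forall>i<n. Q i = A *\<^sub>v (P (\<pi> i) + v))))"

end

theory Submission
  imports Defs "HOL-Library.Product_Lexorder"
begin

text \<open>
  The signed volumes \<open>a\<^sub>I\<close> of a configuration satisfy one linear relation for every set \<open>S\<close> of
  \<open>m + 2\<close> points: the alternating sum of the volumes of the \<open>m + 2\<close> simplices in \<open>S\<close> vanishes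
  (\<open>simplex_volume_cocycle\<close>). These relations determine which rearrangements of the volumes are
  possible.

  If \<open>Q\<close> and \<open>P\<close> have the same volume polynomial, there are a permutation \<open>\<sigma>\<close> of the index tuples
  and signs \<open>\<epsilon>\<^sub>I\<close> with \<open>a\<^sub>I(Q) = \<epsilon>\<^sub>I a\<^bsub>\<sigma> I\<^esub>(P)\<close>. The relation of \<open>Q\<close> for \<open>S\<close> then becomes a
  relation \<open>R(P) = 0\<close> among the volumes of \<open>P\<close>, where \<open>R\<close> depends only on \<open>\<sigma>\<close>, \<open>\<epsilon>\<close> and \<open>S\<close>. There
  are finitely many such \<open>R\<close>, each of them a polynomial. Let \<open>f\<close> be the product of those \<open>R\<close>
  that do not vanish at every configuration, and of all the \<open>a\<^sub>I\<close>. If \<open>f(P) \<noteq> 0\<close>, then each \<open>R\<close>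
  that arises from some \<open>Q\<close> vanishes at every configuration. A polynomial with a nonzero value is
  nonzero, so this argument works over finite fields as well.

  It remains to draw conclusions from the vanishing of \<open>R\<close> everywhere, and evaluation at very
  few configurations is enough. Let \<open>J\<close> be a set of \<open>m\<close> points; put the unit vectors at the points
  of \<open>J\<close> and zero at all other points. At this configuration \<open>a\<^sub>I\<close> is nonzero exactly if
  \<open>J \<subseteq> I\<close> (\<open>simplex_volume_facet_config_nonzero_iff\<close>), so that \<open>R\<close> reduces to the terms of the
  simplices that contain the facet \<open>J\<close>. The proof is completed in three steps.

  \<^item> No facet of a simplex in the support of \<open>R\<close> can belong to that simplex alone. With \<open>m + 2\<close>
    simplices this forces them to be all the simplices of a single set of \<open>m + 2\<close> points
    (\<open>clique_of_facet_sharing\<close>). Hence \<open>\<sigma>\<close> maps the \<open>(m + 1)\<close>-subsets of any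
    \<open>(m + 2)\<close>-set to those of another one, and a map with this property comes from a permutation
    \<open>\<pi>\<close> of the points (\<open>k_subset_map_induced_by_permutation\<close>).
  \<^item> After renumbering the points by \<open>\<pi>\<close>, each facet lies in exactly two simplices of \<open>S\<close>;
    comparison with the original relation shows that the two have the same sign
    (\<open>relation_coefficients_constant\<close>).
  \<^item> So \<open>Q\<close> and the renumbered \<open>P\<close> have the same signed volumes up to one common sign, on all
    simplices that share at least \<open>m\<close> vertices with the first one. By Cramer's rule these volumes
    give the coordinates of each point with respect to the first simplex, so the affine map between
    the two first simplices maps every point correctly
    (\<open>affine_equivalence_of_equal_volumes\<close>).
\<close>

section \<open>Polynomial functions on configurations\<close>

definition monomial_value :: "((nat \<times> nat) \<Rightarrow>\<^sub>0 nat) \<Rightarrow> (nat \<Rightarrow> 'a::comm_semiring_1 vec) \<Rightarrow> 'a" where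
  "monomial_value t P = (\<Prod>(i, k) \<in> Poly_Mapping.keys t. (P i $ k) ^ Poly_Mapping.lookup t (i, k))"

lemma monomial_value_superset:
  assumes "finite A" "Poly_Mapping.keys t \<subseteq> A"
  shows "monomial_value t P = (\<Prod>(i, k) \<in> A. (P i $ k) ^ Poly_Mapping.lookup t (i, k))"
  unfolding monomial_value_def using assms
  by (intro prod.mono_neutral_left) (auto simp: in_keys_iff)

lemma monomial_value_add:
  "monomial_value (s + t) P = monomial_value s P * monomial_value t P"
proof -
  let ?A = "Poly_Mapping.keys s \<union> Poly_Mapping.keys t"
  have A: "finite ?A" by simp
  have "monomial_value (s + t) P = (\<Prod>(i, k) \<in> ?A. (P i $ k) ^ Poly_Mapping.lookup (s + t) (i, k))"
    using keys_add[of s t] by (intro monomial_value_superset A) auto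
  also have "\<dots> = (\<Prod>(i, k) \<in> ?A. (P i $ k) ^ Poly_Mapping.lookup s (i, k)) *
      (\<Prod>(i, k) \<in> ?A. (P i $ k) ^ Poly_Mapping.lookup t (i, k))"
    by (simp add: prod.distrib[symmetric] case_prod_unfold lookup_add power_add)
  also have "\<dots> = monomial_value s P * monomial_value t P"
    using monomial_value_superset[OF A, of s P] monomial_value_superset[OF A, of t P] by simp
  finally show ?thesis .
qed

lemma config_poly_eval_superset:
  assumes "finite A" "Poly_Mapping.keys f \<subseteq> A"
  shows "config_poly_eval f P = (\<Sum>t\<in>A. Poly_Mapping.lookup f t * monomial_value t P)"
  unfolding config_poly_eval_def monomial_value_def[symmetric] using assms
  by (intro sum.mono_neutral_left) (auto simp: in_keys_iff)

lemma config_poly_eval_add: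
  "config_poly_eval (f + g) P = config_poly_eval f P + config_poly_eval g P"
proof -
  let ?A = "Poly_Mapping.keys f \<union> Poly_Mapping.keys g"
  have A: "finite ?A" by simp
  have "Poly_Mapping.keys (f + g) \<subseteq> ?A" by (rule keys_add)
  then show ?thesis
    using config_poly_eval_superset[OF A, of "f + g" P] config_poly_eval_superset[OF A, of f P]
      config_poly_eval_superset[OF A, of g P]
    by (simp add: lookup_add distrib_right sum.distrib)
qed

lemma config_poly_eval_zero [simp]: "config_poly_eval 0 P = 0"
  by (simp add: config_poly_eval_def)

lemma config_poly_eval_sum:
  "config_poly_eval (\<Sum>x\<in>X. f x) P = (\<Sum>x\<in>X. config_poly_eval (f x) P)"
  by (induction X rule: infinite_finite_induct) (auto simp: config_poly_eval_add)

lemma config_poly_eval_single: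
  "config_poly_eval (Poly_Mapping.single t c) P = c * monomial_value t P"
  using config_poly_eval_superset[of "{t}" "Poly_Mapping.single t c" P] by simp

lemma config_poly_eval_mult:
  "config_poly_eval (f * g) P = config_poly_eval f P * config_poly_eval g P"
proof -
  have single_sum: "h = (\<Sum>t\<in>Poly_Mapping.keys h. Poly_Mapping.single t (Poly_Mapping.lookup h t))"
    for h :: "'a config_poly"
    by (rule poly_mapping_eqI) (simp add: lookup_sum lookup_single when_def in_keys_iff)
  have "f * g = (\<Sum>s\<in>Poly_Mapping.keys f. \<Sum>t\<in>Poly_Mapping.keys g.
      Poly_Mapping.single (s + t) (Poly_Mapping.lookup f s * Poly_Mapping.lookup g t))"
    by (subst single_sum[of f], subst single_sum[of g]) (simp add: sum_product mult_single)
  then have "config_poly_eval (f * g) P = (\<Sum>s\<in>Poly_Mapping.keys f. \<Sum>t\<in>Poly_Mapping.keys g.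
      Poly_Mapping.lookup f s * Poly_Mapping.lookup g t * monomial_value (s + t) P)"
    by (simp only: config_poly_eval_sum config_poly_eval_single)
  also have "\<dots> = config_poly_eval f P * config_poly_eval g P"
    unfolding config_poly_eval_def monomial_value_def[symmetric]
    by (simp add: sum_product monomial_value_add mult_ac)
  finally show ?thesis .
qed

definition poly_function ::
  "nat \<Rightarrow> nat \<Rightarrow> ((nat \<Rightarrow> 'a::comm_ring_1 vec) \<Rightarrow> 'a) \<Rightarrow> bool" where
  "poly_function m n F \<longleftrightarrow>
     (\<exists>f \<in> config_poly_ring m n. \<forall>P \<in> configurations m n. config_poly_eval f P = F P)"

lemma poly_function_const: "poly_function m n (\<lambda>_. c)"
  unfolding poly_function_def
  by (rule bexI[of _ "Poly_Mapping.single 0 c"])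
    (auto simp: config_poly_eval_single config_poly_ring_def monomial_value_def)

lemma poly_function_coordinate:
  assumes "i < n" "k < m"
  shows "poly_function m n (\<lambda>P. P i $ k)"
  unfolding poly_function_def
  by (rule bexI[of _ "Poly_Mapping.single (Poly_Mapping.single (i, k) 1) 1"])
    (use assms in \<open>auto simp: config_poly_eval_single config_poly_ring_def monomial_value_def\<close>)

lemma config_poly_ring_mult:
  "f \<in> config_poly_ring m n \<Longrightarrow> g \<in> config_poly_ring m n \<Longrightarrow> f * g \<in> config_poly_ring m n"
  unfolding config_poly_ring_def
proof (intro CollectI ballI)
  fix t assume f: "f \<in> {f. \<forall>t\<in>Poly_Mapping.keys f. Poly_Mapping.keys t \<subseteq> {..<n} \<times> {..<m}}"
    and g: "g \<in> {f. \<forall>t\<in>Poly_Mapping.keys f. Poly_Mapping.keys t \<subseteq> {..<n} \<times> {..<m}}"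
    and t: "t \<in> Poly_Mapping.keys (f * g)"
  from t keys_mult[of f g] obtain a b where ab: "t = a + b" "a \<in> Poly_Mapping.keys f" "b \<in> Poly_Mapping.keys g"
    by blast
  with f g have "Poly_Mapping.keys a \<union> Poly_Mapping.keys b \<subseteq> {..<n} \<times> {..<m}" by blast
  then show "Poly_Mapping.keys t \<subseteq> {..<n} \<times> {..<m}"
    using keys_add[of a b] ab(1) by blast
qed

lemma poly_function_add:
  assumes "poly_function m n F" "poly_function m n G"
  shows "poly_function m n (\<lambda>P. F P + G P)"
proof -
  from assms obtain f g where
    f: "f \<in> config_poly_ring m n" "\<forall>P \<in> configurations m n. config_poly_eval f P = F P" and
    g: "g \<in> config_poly_ring m n" "\<forall>P \<in> configurations m n. config_poly_eval g P = G P"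
    unfolding poly_function_def by blast
  have "f + g \<in> config_poly_ring m n"
    using f(1) g(1) keys_add[of f g] unfolding config_poly_ring_def by blast
  with f(2) g(2) show ?thesis
    unfolding poly_function_def by (intro bexI[of _ "f + g"]) (auto simp: config_poly_eval_add)
qed

lemma poly_function_mult:
  assumes "poly_function m n F" "poly_function m n G"
  shows "poly_function m n (\<lambda>P. F P * G P)"
proof -
  from assms obtain f g where
    f: "f \<in> config_poly_ring m n" "\<forall>P \<in> configurations m n. config_poly_eval f P = F P" and
    g: "g \<in> config_poly_ring m n" "\<forall>P \<in> configurations m n. config_poly_eval g P = G P"
    unfolding poly_function_def by blast
  then show ?thesis
    unfolding poly_function_def
    by (intro bexI[of _ "f * g"]) (auto simp: config_poly_eval_mult config_poly_ring_mult)
qed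

lemma poly_function_diff:
  assumes "poly_function m n F" "poly_function m n G"
  shows "poly_function m n (\<lambda>P. F P - G P)"
  using poly_function_add[OF assms(1) poly_function_mult[OF poly_function_const[of m n "- 1"] assms(2)]]
  by simp

lemma poly_function_sum:
  "(\<And>x. x \<in> X \<Longrightarrow> poly_function m n (F x)) \<Longrightarrow> poly_function m n (\<lambda>P. \<Sum>x\<in>X. F x P)"
  by (induction X rule: infinite_finite_induct)
    (auto intro: poly_function_const poly_function_add)

lemma poly_function_prod:
  "(\<And>x. x \<in> X \<Longrightarrow> poly_function m n (F x)) \<Longrightarrow> poly_function m n (\<lambda>P. \<Prod>x\<in>X. F x P)"
  by (induction X rule: infinite_finite_induct)
    (auto intro: poly_function_const poly_function_mult)

lemma poly_function_cong:
  "poly_function m n F \<Longrightarrow> (\<And>P. P \<in> configurations m n \<Longrightarrow> F P = G P) \<Longrightarrow> poly_function m n G"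
  unfolding poly_function_def by simp

lemma poly_function_simplex_volume:
  assumes "set is \<subseteq> {..<n}" "length is = m + 1"
  shows "poly_function m n (\<lambda>P :: nat \<Rightarrow> 'a::comm_ring_1 vec. simplex_volume m P is)"
proof -
  let ?F = "\<lambda>P :: nat \<Rightarrow> 'a vec. \<Sum>p | p permutes {0..<m}.
     signof p * (\<Prod>i = 0..<m. P (is ! Suc (p i)) $ i - P (is ! 0) $ i)"
  have p: "is ! Suc (p i) < n" "is ! 0 < n" if "p permutes {0..<m}" "i < m" for p i
    using that permutes_in_image[OF that(1), of i] assms nth_mem[of "Suc (p i)" "is"] nth_mem[of 0 "is"] 
    by (auto simp del: nth_mem)
  have "poly_function m n ?F"
    by (intro poly_function_sum poly_function_mult poly_function_const poly_function_prod
        poly_function_diff poly_function_coordinate) (auto simp: p)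
  moreover have "?F P = simplex_volume m P is" if "P \<in> configurations m n" for P
  proof -
    have "(P (is ! Suc (p i)) - P (is ! 0)) $ i = P (is ! Suc (p i)) $ i - P (is ! 0) $ i"
      if "p permutes {0..<m}" "i < m" for p i
    proof -
      have "P (is ! 0) \<in> carrier_vec m"
        using p[OF that] \<open>P \<in> configurations m n\<close> by (auto simp: configurations_def)
      then show ?thesis using that by simp
    qed
    moreover have "is \<noteq> []" using assms(2) by auto
    moreover have "p i < m" if "p permutes {0..<m}" "i < m" for p i
      using permutes_in_image[OF that(1), of i] that by auto
    ultimately show ?thesis
      unfolding simplex_volume_def using assms(2)
      by (subst det_def'[of _ m]) 
        (auto simp: mat_of_cols_index hd_conv_nth nth_tl intro!: sum.cong prod.cong)
  qed
  ultimately show ?thesis by (rule poly_function_cong)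
qed

text \<open>
  The polynomial is a product of polynomials representing the members of the family; each factor is
  nonzero because it has a nonzero value. The product is nonzero because formal polynomials over an
  integral domain form an integral domain, as the monomials admit a linear order compatible with
  multiplication; it is induced by the lexicographic order on the variables.
\<close>
lemma nonvanishing_locus_of_finite_family:
  fixes X :: "((nat \<Rightarrow> 'a::idom vec) \<Rightarrow> 'a) set"
  assumes "finite X" "\<And>F. F \<in> X \<Longrightarrow> poly_function m n F"
    and "\<And>F. F \<in> X \<Longrightarrow> \<exists>P \<in> configurations m n. F P \<noteq> 0"
  shows "\<exists>f \<in> config_poly_ring m n. f \<noteq> 0 \<and>
    (\<forall>P \<in> configurations m n. config_poly_eval f P \<noteq> 0 \<longrightarrow> (\<forall>F\<in>X. F P \<noteq> 0))"
  using assms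
proof (induction X rule: finite_induct)
  case empty
  have "1 \<in> config_poly_ring m n" by (auto simp: config_poly_ring_def)
  then show ?case by (intro bexI[of _ 1]) auto
next
  case (insert F X)
  then obtain f where f: "f \<in> config_poly_ring m n" "f \<noteq> 0"
    "\<forall>P \<in> configurations m n. config_poly_eval f P \<noteq> 0 \<longrightarrow> (\<forall>G\<in>X. G P \<noteq> 0)" by blast
  from insert.prems(1)[of F] obtain g where g: "g \<in> config_poly_ring m n"
    "\<forall>P \<in> configurations m n. config_poly_eval g P = F P" unfolding poly_function_def by blast
  with insert.prems(2)[of F] have "g \<noteq> 0" by auto
  with f g show ?case
    by (intro bexI[of _ "f * g"]) (auto simp: config_poly_eval_mult config_poly_ring_mult)
qed

section \<open>Reordering columns and the homogeneous form of the volume\<close>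

lemma det_mat_of_cols_permute:
  assumes p: "p permutes {..<length ys}"
  shows "det (mat_of_cols (length ys) (map f (permute_list p ys))) =
    (signof p :: 'a::comm_ring_1) * det (mat_of_cols (length ys) (map f ys))"
proof -
  let ?n = "length ys"
  let ?A = "mat_of_rows ?n (map f ys)" and ?B = "mat_of_rows ?n (map f (permute_list p ys))"
  have A: "?A \<in> carrier_mat ?n ?n"
    using mat_of_rows_carrier(1)[of ?n "map f ys"] by simp
  have p': "p permutes {0..<?n}" using p by (simp add: atLeast0LessThan)
  have "?B = mat ?n ?n (\<lambda>(i, j). ?A $$ (p i, j))"
    using permutes_in_image[OF p] p
    by (intro eq_matI) (auto simp: mat_of_rows_def permute_list_nth)
  then have "det ?B = signof p * det ?A"
    using det_permute_rows[OF A p'] by simp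
  moreover have "det (mat_of_cols ?n (map f zs)) = det (mat_of_rows ?n (map f zs))"
    if "length zs = ?n" for zs
    using det_transpose[of "mat_of_rows ?n (map f zs)" ?n]
      mat_of_rows_carrier(1)[of ?n "map f zs"] that by (simp add: transpose_mat_of_rows)
  ultimately show ?thesis by simp
qed

text \<open>
  The sign depends on the two orders only, not on the columns. This uniformity allows one sign to
  serve all configurations at once.
\<close>
lemma det_mat_of_cols_reorder:
  assumes "mset xs = mset ys"
  shows "\<exists>\<tau> :: 'a::comm_ring_1. (\<tau> = 1 \<or> \<tau> = - 1) \<and> (\<forall>f.
    det (mat_of_cols (length ys) (map f xs)) = \<tau> * det (mat_of_cols (length ys) (map f ys)))"
proof -
  obtain p where p: "p permutes {..<length ys}" "permute_list p ys = xs"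
    using mset_eq_permutation[OF assms] by blast
  have "(signof p :: 'a) = 1 \<or> (signof p :: 'a) = - 1" by (simp add: sign_def)
  then show ?thesis
    using det_mat_of_cols_permute[OF p(1), where 'a = 'a] p(2) by (intro exI[of _ "signof p"]) auto
qed

definition affine_lift :: "'a::one vec \<Rightarrow> 'a vec" where
  "affine_lift p = vCons 1 p"

text \<open>
  In the homogeneous form \<open>det (1 \<dots> 1; P\<^sub>0 \<dots> P\<^sub>m)\<close> no vertex is distinguished, so that reordering
  the vertices just permutes columns. The matrix arises from the block matrix
  \<open>(1 0; P\<^sub>0 N)\<close>, where \<open>N\<close> has the columns \<open>P\<^sub>i - P\<^sub>0\<close>, by adding the column \<open>0\<close> to all others, which
  is right multiplication by a unitriangular matrix.
\<close>
lemma simplex_volume_eq_det_affine_lift: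
  fixes P :: "nat \<Rightarrow> 'a::idom vec"
  assumes len: "length is = m + 1" and P: "\<And>i. i \<in> set is \<Longrightarrow> P i \<in> carrier_vec m"
  shows "simplex_volume m P is = det (mat_of_cols (m + 1) (map (\<lambda>i. affine_lift (P i)) is))"
proof -
  obtain a js where "is": "is = a # js" and js: "length js = m"
    using len by (cases "is") auto
  let ?N = "mat_of_cols m (map (\<lambda>i. P i - P a) js)"
  let ?M = "four_block_mat (1\<^sub>m 1) (0\<^sub>m 1 m) (mat_of_cols m [P a]) ?N"
  let ?U = "mat (m + 1) (m + 1) (\<lambda>(i, j). if i = 0 \<or> i = j then 1 else 0 :: 'a)"
  have N: "?N \<in> carrier_mat m m" using js by auto
  have M: "?M \<in> carrier_mat (m + 1) (m + 1)" using js by auto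
  have dims: "dim_vec (P a) = m" "\<And>j. j < m \<Longrightarrow> dim_vec (P (js ! j)) = m"
    using P js unfolding "is" by (auto simp: carrier_vecD)
  have "det ?M = det (1\<^sub>m 1 :: 'a mat) * det ?N"
    by (rule det_four_block_mat_upper_right_zero[of _ 1 _ m]) (use js in auto)
  moreover have "det ?U = 1"
  proof -
    have "det ?U = prod_list (diag_mat ?U)"
      by (rule det_upper_triangular[of _ "m + 1"]) (auto simp: upper_triangular_def)
    also have "diag_mat ?U = map (\<lambda>_. 1) [0..<m + 1]"
      by (auto simp: diag_mat_def simp del: upt_Suc)
    finally show ?thesis by (simp add: map_replicate_const prod_list_replicate)
  qed
  moreover have "mat_of_cols (m + 1) (map (\<lambda>i. affine_lift (P i)) is) = ?M * ?U"
  proof (rule eq_matI)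
    fix i j assume ij: "i < dim_row (?M * ?U)" "j < dim_col (?M * ?U)"
    then have i: "i < m + 1" and j: "j < m + 1" using js by auto
    have M_0: "?M $$ (i, 0) = (if i = 0 then 1 else P a $ (i - 1))"
      using i js by (simp add: mat_of_cols_index)
    have M_Suc: "?M $$ (i, Suc l) = (if i = 0 then 0 else P (js ! l) $ (i - 1) - P a $ (i - 1))"
      if "l < m" for l
      using i js that dims by (simp add: mat_of_cols_index)
    have "(?M * ?U) $$ (i, j) = (\<Sum>k = 0..<m + 1. ?M $$ (i, k) * ?U $$ (k, j))"
      using i j M by (auto simp: scalar_prod_def simp del: sum.op_ivl_Suc intro!: sum.cong)
    also have "\<dots> = (\<Sum>k\<in>{0..<m + 1}. if k = 0 \<or> k = j then ?M $$ (i, k) else 0)"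
      by (rule sum.cong) (use j in auto)
    also have "\<dots> = (\<Sum>k\<in>{0, j}. ?M $$ (i, k))"
      by (rule sum.mono_neutral_cong_right) (use j in auto)
    also have "\<dots> = mat_of_cols (m + 1) (map (\<lambda>i. affine_lift (P i)) is) $$ (i, j)"
    proof (cases j)
      case 0
      then show ?thesis using M_0 i by (cases i) (simp_all add: "is" affine_lift_def mat_of_cols_Cons_index_0)
    next
      case (Suc l)
      then have "mat_of_cols (m + 1) (map (\<lambda>i. affine_lift (P i)) is) $$ (i, j) = affine_lift (P (js ! l)) $ i"
        using i j js by (simp add: "is" mat_of_cols_index)
      then show ?thesis using M_0 M_Suc[of l] Suc i j by (cases i) (simp_all add: affine_lift_def)
    qed
    finally show "mat_of_cols (m + 1) (map (\<lambda>i. affine_lift (P i)) is) $$ (i, j) = (?M * ?U) $$ (i, j)"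
      by simp
  qed (use js "is" in auto)
  ultimately have "det (mat_of_cols (m + 1) (map (\<lambda>i. affine_lift (P i)) is)) = det ?N"
    using det_mult[OF M, of ?U] by simp
  then show ?thesis by (simp add: simplex_volume_def "is")
qed

lemma simplex_volume_reorder:
  assumes "mset xs = mset ys" "length ys = m + 1"
  shows "\<exists>\<tau> :: 'a::idom. (\<tau> = 1 \<or> \<tau> = - 1) \<and>
    (\<forall>P. (\<forall>i\<in>set ys. P i \<in> carrier_vec m) \<longrightarrow> simplex_volume m P xs = \<tau> * simplex_volume m P ys)"
proof -
  have "set xs = set ys" "length xs = m + 1"
    using mset_eq_setD[OF assms(1)] mset_eq_length[OF assms(1)] assms(2) by auto
  moreover obtain \<tau> :: 'a where \<tau>: "\<tau> = 1 \<or> \<tau> = - 1" "\<And>f. det (mat_of_cols (length ys) (map f xs)) =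
      \<tau> * det (mat_of_cols (length ys) (map f ys))"
    using det_mat_of_cols_reorder[OF assms(1), where 'a = 'a] by blast
  ultimately have "simplex_volume m P xs = \<tau> * simplex_volume m P ys"
    if "\<forall>i\<in>set ys. P i \<in> carrier_vec m" for P
    using that assms(2) \<tau>(2)[of "\<lambda>i. affine_lift (P i)"]
      simplex_volume_eq_det_affine_lift[of xs m P] simplex_volume_eq_det_affine_lift[of ys m P] by simp
  with \<tau>(1) show ?thesis by (intro exI[of _ \<tau>] conjI allI impI)
qed


section \<open>The linear relations between volumes\<close>

definition delete_nth :: "nat \<Rightarrow> 'b list \<Rightarrow> 'b list" where
  "delete_nth j xs = take j xs @ drop (Suc j) xs"

lemma length_delete_nth: "j < length xs \<Longrightarrow> length (delete_nth j xs) = length xs - 1"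
  by (simp add: delete_nth_def)

lemma nth_delete_nth:
  "j < length xs \<Longrightarrow> i < length xs - 1 \<Longrightarrow>
     delete_nth j xs ! i = xs ! (if i < j then i else Suc i)"
  by (auto simp: delete_nth_def nth_append min_def)

lemma set_delete_nth:
  assumes "distinct xs" "j < length xs"
  shows "set (delete_nth j xs) = set xs - {xs ! j}"
proof -
  have "distinct (take j xs @ xs ! j # drop (Suc j) xs)" "set xs = set (take j xs @ xs ! j # drop (Suc j) xs)"
    using assms by (simp_all add: id_take_nth_drop[symmetric])
  then show ?thesis unfolding delete_nth_def by auto
qed

text \<open>
  Expand the determinant with columns \<open>(1, 1, P\<^sub>i)\<close> along its first row. It is zero because two rows
  agree, and its minors are volumes in homogeneous form.
\<close>
lemma simplex_volume_cocycle:
  fixes P :: "nat \<Rightarrow> 'a::idom vec"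
  assumes len: "length S = m + 2" and P: "\<And>i. i \<in> set S \<Longrightarrow> P i \<in> carrier_vec m"
  shows "(\<Sum>j<m + 2. (- 1) ^ j * simplex_volume m P (delete_nth j S)) = 0"
proof -
  let ?M = "mat_of_cols (m + 2) (map (\<lambda>i. vCons 1 (affine_lift (P i))) S)"
  have M: "?M \<in> carrier_mat (m + 2) (m + 2)" using len by auto
  have "det ?M = 0"
    by (rule det_identical_rows[OF M, of 0 1]) (auto simp: len mat_of_cols_index affine_lift_def intro!: eq_vecI)
  moreover have "cofactor ?M 0 j = (- 1) ^ j * simplex_volume m P (delete_nth j S)" if "j < m + 2" for j
  proof -
    have "mat_delete ?M 0 j = mat_of_cols (m + 1) (map (\<lambda>i. affine_lift (P i)) (delete_nth j S))"
      using that len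
      by (intro eq_matI) (auto simp: mat_delete_def mat_of_cols_index length_delete_nth nth_delete_nth)
    moreover have "set (delete_nth j S) \<subseteq> set S"
      unfolding delete_nth_def by (auto dest: in_set_takeD in_set_dropD)
    ultimately show ?thesis
      using that len P
      by (subst simplex_volume_eq_det_affine_lift) (auto simp: cofactor_def length_delete_nth)
  qed
  ultimately show ?thesis
    using laplace_expansion_row[OF M, of 0] len by (simp add: mat_of_cols_index)
qed

section \<open>Configurations that isolate a facet\<close>

text \<open>
  The point with index \<open>js ! k\<close> is the \<open>k\<close>-th unit vector; every point outside \<open>js\<close> is zero.
\<close>
definition facet_config :: "nat list \<Rightarrow> nat \<Rightarrow> 'a::zero_neq_one vec" where
  "facet_config js i = vec (length js) (\<lambda>k. of_bool (js ! k = i))"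

text \<open>
  If the simplex contains the facet, its remaining vertex is the origin and its edges from there are
  the unit vectors. If it does not, two of its vertices lie outside the facet, hence coincide.
\<close>
lemma simplex_volume_facet_config_nonzero_iff:
  assumes js: "distinct js" "length js = m" and "is": "distinct is" "length is = m + 1"
  shows "simplex_volume m (facet_config js) is \<noteq> (0 :: 'a::idom) \<longleftrightarrow> set js \<subseteq> set is"
proof
  assume sub: "set js \<subseteq> set is"
  have "card (set is - set js) = 1"
    using sub js "is" by (simp add: card_Diff_subset distinct_card)
  then obtain a where a: "set is - set js = {a}" by (auto simp: card_1_singleton_iff)
  \<comment> \<open>Take the vertex at the origin as the base point.\<close>
  have "mset is = mset (a # js)"
    using a sub js "is" by (intro set_eq_iff_mset_eq_distinct[THEN iffD1]) auto
  then obtain \<tau> :: 'a where "\<tau> = 1 \<or> \<tau> = - 1"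
    and \<tau>: "simplex_volume m (facet_config js) is = \<tau> * simplex_volume m (facet_config js) (a # js)"
    using simplex_volume_reorder[of "is" "a # js" m, where 'a = 'a] js
    by (fastforce simp: facet_config_def)
  moreover have "simplex_volume m (facet_config js) (a # js) = (1 :: 'a)"
  proof -
    have "mat_of_cols m (map (\<lambda>i. facet_config js i - facet_config js a) js) = (1\<^sub>m m :: 'a mat)"
      using js a by (intro eq_matI)
        (auto simp: mat_of_cols_index facet_config_def nth_eq_iff_index_eq, (metis DiffD2 insertI1 nth_mem)+)
    then show ?thesis by (simp add: simplex_volume_def)
  qed
  ultimately show "simplex_volume m (facet_config js) is \<noteq> (0 :: 'a)" by auto
next
  assume nz: "simplex_volume m (facet_config js) is \<noteq> (0 :: 'a)"
  show "set js \<subseteq> set is"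
  proof (rule ccontr)
    assume "\<not> set js \<subseteq> set is"
    then have "card (set js \<inter> set is) < card (set js)" by (intro psubset_card_mono) auto
    moreover have "card (set is - set js) = card (set is) - card (set js \<inter> set is)"
      by (simp add: card_Diff_subset_Int Int_commute)
    ultimately have "\<not> card (set is - set js) \<le> Suc 0"
      using js "is" by (simp add: distinct_card)
    then obtain a b where ab: "a \<in> set is - set js" "b \<in> set is - set js" "a \<noteq> b"
      by (auto simp: card_le_Suc0_iff_eq)
    then obtain i j where ij: "i < m + 1" "j < m + 1" "is ! i = a" "is ! j = b" "i \<noteq> j"
      using "is" by (auto simp: in_set_conv_nth)
    have zero: "facet_config js c = (0\<^sub>v m :: 'a vec)" if "c \<notin> set js" for c
      using that js by (auto simp: facet_config_def intro!: eq_vecI)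
    have car: "affine_lift (facet_config js c) \<in> carrier_vec (m + 1)" for c
      using js by (auto simp: affine_lift_def facet_config_def carrier_vecI)
    have "det (mat_of_cols (m + 1) (map (\<lambda>i. affine_lift (facet_config js i)) is)) = (0 :: 'a)"
    proof (rule det_identical_columns[of _ "m + 1" i j])
      show "col (mat_of_cols (m + 1) (map (\<lambda>i. affine_lift (facet_config js i)) is)) i =
          col (mat_of_cols (m + 1) (map (\<lambda>i. affine_lift (facet_config js i :: 'a vec)) is)) j"
        using ij ab "is" car[unfolded affine_lift_def] zero by (auto simp: affine_lift_def)
    qed (use ij "is" in auto)
    with nz show False
      using js "is" by (simp add: simplex_volume_eq_det_affine_lift facet_config_def)
  qed
qed

lemma facet_config_in_configurations: "length js = m \<Longrightarrow> facet_config js \<in> configurations m n"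
  by (auto simp: configurations_def facet_config_def)

text \<open>
  For two simplices \<open>S - {s\<^sub>i}\<close> and \<open>S - {s\<^sub>j}\<close> consider the configuration that isolates their common
  facet. There only these two terms survive, both in the given relation and in the relation
  with all coefficients \<open>1\<close>, and their values are nonzero. So the two coefficients agree, without
  any computation of signs. They are field elements, and in characteristic \<open>2\<close> the two signs are
  the same element.
\<close>
lemma relation_coefficients_constant:
  fixes c :: "nat \<Rightarrow> 'a::field"
  assumes S: "distinct S" "length S = m + 2"
    and relation: "\<And>P. P \<in> configurations m n \<Longrightarrow>
      (\<Sum>j<m + 2. (- 1) ^ j * (c j * simplex_volume m P (delete_nth j S))) = 0"
    and ij: "i < m + 2" "j < m + 2"
  shows "c i = c j"
proof (cases "i = j")
  case False
  define js where "js = filter (\<lambda>x. x \<noteq> S ! i \<and> x \<noteq> S ! j) S"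
  have ne: "S ! i \<noteq> S ! j" using False S ij by (simp add: nth_eq_iff_index_eq)
  have set_js: "set js = set S - {S ! i, S ! j}" by (auto simp: js_def)
  have js: "distinct js" "length js = m"
  proof -
    show "distinct js" using S by (simp add: js_def)
    have "card (set S - {S ! i, S ! j}) = m"
      using S ij ne by (simp add: card_Diff_subset distinct_card)
    then show "length js = m" using \<open>distinct js\<close> distinct_card set_js by metis
  qed
  let ?v = "\<lambda>k. simplex_volume m (facet_config js) (delete_nth k S) :: 'a"
  have v_iff: "?v k \<noteq> 0 \<longleftrightarrow> k \<in> {i, j}" if k: "k < m + 2" for k
  proof -
    have set_del: "set (delete_nth k S) = set S - {S ! k}"
      using S k by (simp add: set_delete_nth)
    have len_del: "length (delete_nth k S) = m + 1" using S k by (simp add: length_delete_nth)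
    have "card (set S - {S ! k}) = m + 1" using S k by (simp add: distinct_card)
    then have "distinct (delete_nth k S)"
      using set_del len_del by (intro card_distinct) simp
    then have "?v k \<noteq> 0 \<longleftrightarrow> set js \<subseteq> set S - {S ! k}"
      using simplex_volume_facet_config_nonzero_iff[OF js, of "delete_nth k S", where 'a = 'a] set_del len_del
      by simp
    also have "\<dots> \<longleftrightarrow> S ! k \<in> {S ! i, S ! j}" using set_js S k by auto
    also have "\<dots> \<longleftrightarrow> k \<in> {i, j}" using S ij k by (auto simp: nth_eq_iff_index_eq)
    finally show ?thesis .
  qed
  have two_terms: "(\<Sum>k<m + 2. (- 1) ^ k * (d k * ?v k)) =
      (- 1) ^ i * (d i * ?v i) + (- 1) ^ j * (d j * ?v j)" for d :: "nat \<Rightarrow> 'a"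
  proof -
    have "(\<Sum>k<m + 2. (- 1) ^ k * (d k * ?v k)) = (\<Sum>k\<in>{i, j}. (- 1) ^ k * (d k * ?v k))"
      using v_iff ij by (intro sum.mono_neutral_right) auto
    then show ?thesis using False by simp
  qed
  have config: "facet_config js \<in> configurations m n" using js(2) by (rule facet_config_in_configurations)
  have "(\<Sum>k<m + 2. (- 1) ^ k * ?v k) = 0"
    using S js by (intro simplex_volume_cocycle) (auto simp: facet_config_def)
  then have "(- 1) ^ i * ?v i + (- 1) ^ j * ?v j = 0"
    using two_terms[of "\<lambda>_. 1"] by simp
  then have j_term: "(- 1) ^ j * ?v j = - ((- 1) ^ i * ?v i)" by (simp add: add_eq_0_iff)
  have "c i * ((- 1) ^ i * ?v i) + c j * ((- 1) ^ j * ?v j) = 0"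
    using relation[OF config] two_terms[of c] by (simp add: mult_ac)
  then have "(c i - c j) * ((- 1) ^ i * ?v i) = 0"
    unfolding j_term by (simp add: algebra_simps)
  then show ?thesis using v_iff[OF ij(1)] by simp
qed simp

section \<open>Maps of k-subsets that preserve cliques\<close>

lemma Union_of_two_k_subsets:
  assumes "finite S" "card S = k + 1" "A \<subseteq> S" "B \<subseteq> S" "card A = k" "card B = k" "A \<noteq> B"
  shows "A \<union> B = S"
proof (rule card_seteq)
  have fin: "finite A" "finite B" using assms finite_subset by blast+
  have "A \<subset> A \<union> B"
    using card_subset_eq[OF fin(1), of B] assms(5-7) by auto
  then have "card A < card (A \<union> B)" using fin by (intro psubset_card_mono) auto
  then show "card S \<le> card (A \<union> B)" using assms by simp
qed (use assms in auto)

text \<open>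
  A set \<open>A\<close> in the family has \<open>k\<close> facets, each contained in another member. These members are
  different for different facets, since each of them misses the vertex opposite to its facet. As
  there are just \<open>k\<close> other members, they correspond to the facets of \<open>A\<close> one to one; in particular
  any two members differ by the exchange of one element. If \<open>B\<close> and \<open>C\<close> are obtained
  from \<open>A\<close> by adding \<open>y\<close> and \<open>x\<close> in place of two different elements, then \<open>x = y\<close>, because otherwise
  \<open>B\<close> and \<open>C\<close> would differ by two elements. So only one element outside \<open>A\<close> occurs.
\<close>
lemma clique_of_facet_sharing:
  fixes X :: "'a set set"
  assumes card_X: "card X = k + 1" and k: "k \<ge> 2"
    and sets: "\<And>A. A \<in> X \<Longrightarrow> finite A \<and> card A = k"
    and facets: "\<And>A a. A \<in> X \<Longrightarrow> a \<in> A \<Longrightarrow> \<exists>B \<in> X. B \<noteq> A \<and> A - {a} \<subseteq> B"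
  shows "finite (\<Union>X) \<and> card (\<Union>X) = k + 1"
proof -
  have finX: "finite X" using card_X by (metis Suc_eq_plus1 card.infinite nat.distinct(1))
  have exchange: "\<exists>g. g ` A = X - {A} \<and> (\<forall>a\<in>A. \<exists>x. x \<notin> A \<and> g a = insert x (A - {a}))"
    if A: "A \<in> X" for A
  proof -
    have "\<forall>a\<in>A. \<exists>B \<in> X. B \<noteq> A \<and> A - {a} \<subseteq> B" using facets A by blast
    then obtain g where g: "\<And>a. a \<in> A \<Longrightarrow> g a \<in> X \<and> g a \<noteq> A \<and> A - {a} \<subseteq> g a" by metis
    have form: "\<exists>x. x \<notin> A \<and> g a = insert x (A - {a})" if a: "a \<in> A" for a
    proof -
      have "card (A - {a}) = k - 1" "finite (g a)" "card (g a) = k"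
        using sets A g[OF a] a by auto
      then have "card (g a - (A - {a})) = 1"
        using g[OF a] k sets[OF A] by (simp add: card_Diff_subset)
      then obtain x where x: "g a - (A - {a}) = {x}" by (auto simp: card_1_singleton_iff)
      then have ga: "g a = insert x (A - {a})" using g[OF a] by blast
      have "x \<notin> A" using x ga g[OF a] a by auto
      with ga show ?thesis by blast
    qed
    have "inj_on g A"
    proof (rule inj_onI, rule ccontr)
      fix a b assume ab: "a \<in> A" "b \<in> A" "g a = g b" "a \<noteq> b"
      have "b \<in> g a" using form[OF ab(1)] ab by auto
      moreover have "b \<notin> g b" using form[OF ab(2)] ab(2) by auto
      ultimately show False using ab(3) by simp
    qed
    then have "card (g ` A) = k" using sets[OF A] by (simp add: card_image)
    moreover have "card (X - {A}) = k" using card_X A finX by simp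
    moreover have "g ` A \<subseteq> X - {A}" using g by auto
    ultimately have "g ` A = X - {A}" using finX by (intro card_subset_eq) auto
    then show ?thesis using form by blast
  qed
  have "\<not> card X \<le> Suc 0" using card_X k by simp
  then obtain A B where AB: "A \<in> X" "B \<in> X" "B \<noteq> A"
    using finX by (auto simp: card_le_Suc0_iff_eq)
  from exchange[OF AB(1)] obtain g where
    "g ` A = X - {A} \<and> (\<forall>a\<in>A. \<exists>x. x \<notin> A \<and> g a = insert x (A - {a}))" ..
  then have g: "g ` A = X - {A}" "\<And>a. a \<in> A \<Longrightarrow> \<exists>x. x \<notin> A \<and> g a = insert x (A - {a})"
    by simp_all
  have "B \<in> g ` A" using g(1) AB by simp
  then obtain b where b: "b \<in> A" "g b = B" by auto
  from g(2)[OF b(1)] obtain y where y: "y \<notin> A" "B = insert y (A - {b})" using b(2) by auto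
  have "C \<subseteq> insert y A" if C: "C \<in> X" for C
  proof (cases "C = A \<or> C = B")
    case False
    have "C \<in> g ` A" using g(1) C False by simp
    then obtain c where c: "c \<in> A" "g c = C" by auto
    from g(2)[OF c(1)] obtain x where x: "x \<notin> A" "C = insert x (A - {c})" using c(2) by auto
    have "b \<noteq> c" using b(2) c(2) False by auto
    from exchange[OF AB(2)] obtain h where
      h: "h ` B = X - {B} \<and> (\<forall>a\<in>B. \<exists>x. x \<notin> B \<and> h a = insert x (B - {a}))" ..
    then have "C \<in> h ` B" using C False by simp
    then obtain d where d: "d \<in> B" "h d = C" by auto
    then obtain z where z: "C = insert z (B - {d})" using h by auto
    have "x = y"
    proof (rule ccontr)
      assume "x \<noteq> y"
      \<comment> \<open>Then \<open>C\<close> misses both \<open>y\<close> and \<open>c\<close>, although it misses only one element of \<open>B\<close>.\<close>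
      then have "y \<notin> C" "y \<in> B" "c \<notin> C" "c \<in> B" "c \<noteq> y" using x y c b \<open>b \<noteq> c\<close> by auto
      then show False using z by auto
    qed
    then show ?thesis using x by auto
  qed (use y in auto)
  moreover have "insert y A \<subseteq> \<Union>X" using AB(1,2) y by auto
  ultimately have "\<Union>X = insert y A" by auto
  then show ?thesis using sets[OF AB(1)] y(1) by simp
qed

text \<open>
  Downward induction on \<open>k\<close>. For \<open>k = card N - 1\<close> a map of \<open>k\<close>-subsets is a map of their
  complements, which are single points. For smaller \<open>k\<close> the map \<open>s\<close> induces a map \<open>t\<close> on
  \<open>(k + 1)\<close>-subsets, and \<open>t\<close> inherits the hypotheses. By induction \<open>t\<close> comes from a permutation, and
  then so does \<open>s\<close>, since a \<open>k\<close>-subset is the intersection of two \<open>(k + 1)\<close>-subsets.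
\<close>
lemma k_subset_map_induced_by_permutation:
  assumes "finite N" "1 \<le> k" "k < card N"
    and "\<And>I. I \<subseteq> N \<Longrightarrow> card I = k \<Longrightarrow> s I \<subseteq> N \<and> card (s I) = k"
    and "inj_on s {I. I \<subseteq> N \<and> card I = k}"
    and "\<And>S. S \<subseteq> N \<Longrightarrow> card S = k + 1 \<Longrightarrow>
      \<exists>S'. S' \<subseteq> N \<and> card S' = k + 1 \<and> (\<forall>I. I \<subseteq> S \<and> card I = k \<longrightarrow> s I \<subseteq> S')"
  shows "\<exists>\<pi>. \<pi> permutes N \<and> (\<forall>I. I \<subseteq> N \<and> card I = k \<longrightarrow> s I = \<pi> ` I)"
  using assms(2-)
proof (induction "card N - k" arbitrary: k s rule: less_induct)
  case (less k s)
  note s = less.prems(3) and inj = less.prems(4) and clique = less.prems(5)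
  have fin: "finite S" if "S \<subseteq> N" for S using that \<open>finite N\<close> finite_subset by blast
  show ?case
  proof (cases "k + 1 = card N")
    case True
    have co: "card (N - {x}) = k" if "x \<in> N" for x using that True \<open>finite N\<close> by simp
    have "\<exists>y\<in>N. s (N - {x}) = N - {y}" if "x \<in> N" for x
    proof -
      have sx: "s (N - {x}) \<subseteq> N" "card (s (N - {x})) = k" using s[of "N - {x}"] co that by auto
      then have "card (N - s (N - {x})) = 1" using True fin[OF sx(1)] by (simp add: card_Diff_subset)
      then obtain y where "N - s (N - {x}) = {y}" by (auto simp: card_1_singleton_iff)
      then show ?thesis using sx(1) by (intro bexI[of _ y]) auto
    qed
    then obtain p where p: "\<And>x. x \<in> N \<Longrightarrow> p x \<in> N \<and> s (N - {x}) = N - {p x}" by metis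
    define \<pi> where "\<pi> x = (if x \<in> N then p x else x)" for x
    have inj_p: "inj_on \<pi> N"
    proof (rule inj_onI)
      fix x y assume xy: "x \<in> N" "y \<in> N" "\<pi> x = \<pi> y"
      then have "s (N - {x}) = s (N - {y})" using p by (simp add: \<pi>_def)
      then have "N - {x} = N - {y}" using inj_onD[OF inj] co xy by blast
      then show "x = y" using xy by blast
    qed
    have "\<pi> ` N = N" using inj_p p \<open>finite N\<close> by (intro endo_inj_surj) (auto simp: \<pi>_def)
    then have "\<pi> permutes N" using inj_p by (intro bij_imp_permutes) (auto simp: bij_betw_def \<pi>_def)
    moreover have "s I = \<pi> ` I" if I: "I \<subseteq> N" "card I = k" for I
    proof -
      have "card (N - I) = 1" using I True fin by (simp add: card_Diff_subset)
      then obtain x where x: "N - I = {x}" by (auto simp: card_1_singleton_iff)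
      then have "I = N - {x}" "x \<in> N" using I by auto
      moreover have "\<pi> ` (N - {x}) = N - {\<pi> x}"
        using inj_p \<open>\<pi> ` N = N\<close> \<open>x \<in> N\<close> by (auto simp: inj_on_def)
      ultimately show ?thesis using p by (simp add: \<pi>_def)
    qed
    ultimately show ?thesis by blast
  next
    case False
    then have k: "k + 1 < card N" using less.prems(2) by simp
    obtain t where t: "\<And>S. S \<subseteq> N \<Longrightarrow> card S = k + 1 \<Longrightarrow>
        t S \<subseteq> N \<and> card (t S) = k + 1 \<and> (\<forall>I. I \<subseteq> S \<and> card I = k \<longrightarrow> s I \<subseteq> t S)"
      using clique by metis
    then have sub_t: "s I \<subseteq> t S" if "S \<subseteq> N" "card S = k + 1" "I \<subseteq> S" "card I = k" for I S
      using that by blast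
    have facet: "card (S - {x}) = k" if "card S = k + 1" "x \<in> S" for S :: "'a set" and x
      using that by (metis add_diff_cancel_right' card_Diff_singleton)
    have tS_eq: "t S = s I \<union> s J"
      if S: "S \<subseteq> N" "card S = k + 1" and IJ: "I \<subseteq> S" "J \<subseteq> S" "card I = k" "card J = k" "I \<noteq> J" for S I J
    proof -
      have "s I \<noteq> s J" using inj_onD[OF inj, of I J] IJ S by blast
      then have "s I \<union> s J = t S"
        using t[OF S] s IJ S fin by (intro Union_of_two_k_subsets[where k = k]) auto
      then show ?thesis by simp
    qed
    \<comment> \<open>The \<open>k\<close>-subsets of \<open>t S\<close> are exactly the images of those of \<open>S\<close>, so \<open>t S\<close> determines \<open>S\<close>.\<close>
    have inj_t: "inj_on t {I. I \<subseteq> N \<and> card I = k + 1}"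
    proof (rule inj_onI, rule ccontr)
      fix S T assume "S \<in> {I. I \<subseteq> N \<and> card I = k + 1}" "T \<in> {I. I \<subseteq> N \<and> card I = k + 1}"
        and eq: "t S = t T" and "S \<noteq> T"
      then have S: "S \<subseteq> N" "card S = k + 1" and T: "T \<subseteq> N" "card T = k + 1" by auto
      define K where "K A = {I. I \<subseteq> A \<and> card I = k}" for A :: "'a set"
      have card_K: "card (K A) = k + 1" "finite (K A)" if "A \<subseteq> N" "card A = k + 1" for A
        using n_subsets[OF fin[OF that(1)], of k] that fin unfolding K_def by auto
      have sK: "s ` K A = K (t A)" if A: "A \<subseteq> N" "card A = k + 1" for A
      proof (rule card_subset_eq)
        show "finite (K (t A))" using t[OF A] card_K by blast
        show "s ` K A \<subseteq> K (t A)" using t[OF A] s A unfolding K_def by auto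
        have "inj_on s (K A)" using inj A unfolding K_def by (rule_tac inj_on_subset) auto
        then show "card (s ` K A) = card (K (t A))" using card_K t A by (simp add: card_image)
      qed
      have "s ` K S = s ` K T" using sK S T eq by simp
      then have "K S = K T"
        using inj S T by (subst (asm) inj_on_image_eq_iff[OF inj]) (auto simp: K_def)
      moreover have "\<Union>(K A) = A" if "A \<subseteq> N" "card A = k + 1" for A
      proof
        show "A \<subseteq> \<Union>(K A)"
        proof
          fix x assume x: "x \<in> A"
          have "A \<noteq> {x}" using that less.prems(1) by auto
          then obtain y where "y \<in> A" "y \<noteq> x" using x by blast
          then have "A - {y} \<in> K A" "x \<in> A - {y}" using facet that x by (auto simp: K_def)
          then show "x \<in> \<Union>(K A)" by blast
        qed
      qed (auto simp: K_def)
      ultimately show False using S T \<open>S \<noteq> T\<close> by metis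
    qed
    have "\<exists>\<pi>. \<pi> permutes N \<and> (\<forall>S. S \<subseteq> N \<and> card S = k + 1 \<longrightarrow> t S = \<pi> ` S)"
    proof (rule less.hyps)
      show "\<exists>S'. S' \<subseteq> N \<and> card S' = k + 1 + 1 \<and> (\<forall>I. I \<subseteq> T \<and> card I = k + 1 \<longrightarrow> t I \<subseteq> S')"
        if T: "T \<subseteq> N" "card T = k + 1 + 1" for T
      proof -
        have finT: "finite T" using T fin by blast
        have sub: "card (T - {x}) = k + 1" if "x \<in> T" for x using that T finT by simp
        have sub2: "card (T - {x, y}) = k" if "x \<in> T" "y \<in> T" "x \<noteq> y" for x y
          using that T finT by (simp add: card_Diff_subset)
        have "\<not> card T \<le> Suc 0" using T by simp
        then obtain x y where xy: "x \<in> T" "y \<in> T" "x \<noteq> y"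
          using finT by (auto simp: card_le_Suc0_iff_eq)
        \<comment> \<open>Any third \<open>t (T - {z})\<close> is the union of its \<open>k\<close>-subsets \<open>s (T - {x, z})\<close> and \<open>s (T - {y, z})\<close>,
            which lie in \<open>t (T - {x})\<close> and \<open>t (T - {y})\<close>.\<close>
        let ?S' = "t (T - {x}) \<union> t (T - {y})"
        have tx: "t (T - {z}) \<subseteq> N" "card (t (T - {z})) = k + 1" "finite (t (T - {z}))" if "z \<in> T" for z
          using t[of "T - {z}"] sub[OF that] T fin[of "t (T - {z})"] by auto
        have sxy: "s (T - {u, v}) \<subseteq> t (T - {u}) \<inter> t (T - {v})" if "u \<in> T" "v \<in> T" "u \<noteq> v" for u v
          using sub_t[OF _ sub[OF that(1)] _ sub2[OF that]] sub_t[OF _ sub[OF that(2)] _ sub2[OF that]] T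
          by blast
        have third: "t (T - {z}) \<subseteq> ?S'" if z: "z \<in> T" for z
        proof (cases "z = x \<or> z = y")
          case False
          then have "t (T - {z}) = s (T - {x, z}) \<union> s (T - {y, z})"
            using xy z T sub[OF z] sub2 by (intro tS_eq) auto
          then show ?thesis using sxy[of x z] sxy[of y z] xy z False by auto
        qed auto
        moreover have "card ?S' = k + 1 + 1"
        proof -
          have "T - {x} \<noteq> T - {y}" using xy by blast
          then have ne: "t (T - {x}) \<noteq> t (T - {y})"
            using inj_onD[OF inj_t, of "T - {x}" "T - {y}"] sub xy T by auto
          have "\<not> t (T - {y}) \<subseteq> t (T - {x})"
            using card_subset_eq[OF tx(3)[OF xy(1)], of "t (T - {y})"] tx(2)[OF xy(1)] tx(2)[OF xy(2)] ne
            by metis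
          then have "t (T - {x}) \<subset> ?S'" by blast
          then have "k + 1 < card ?S'" using psubset_card_mono[of ?S'] tx xy by fastforce
          moreover have "k \<le> card (t (T - {x}) \<inter> t (T - {y}))"
          proof -
            have "T - {x, y} \<subseteq> N" using T by blast
            then have "card (s (T - {x, y})) = k" using s sub2[OF xy] by blast
            then show ?thesis using card_mono[OF _ sxy[OF xy]] tx(3)[OF xy(1)] by simp
          qed
          moreover have "card ?S' + card (t (T - {x}) \<inter> t (T - {y})) = (k + 1) + (k + 1)"
            using card_Un_Int[OF tx(3) tx(3), OF xy(1,2)] tx xy by simp
          ultimately show ?thesis by simp
        qed
        moreover have "\<exists>z\<in>T. I = T - {z}" if "I \<subseteq> T" "card I = k + 1" for I
        proof -
          have "card (T - I) = 1" using that T finT finite_subset by (metis card_Diff_subset add_diff_cancel_left')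
          then obtain z where "T - I = {z}" by (auto simp: card_1_singleton_iff)
          then show ?thesis using that by (intro bexI[of _ z]) auto
        qed
        ultimately show ?thesis using tx xy by (intro exI[of _ ?S']) (metis Un_least)
      qed
    qed (use k less.prems t inj_t in auto)
    then obtain \<pi> where "\<pi> permutes N \<and> (\<forall>S. S \<subseteq> N \<and> card S = k + 1 \<longrightarrow> t S = \<pi> ` S)" ..
    then have \<pi>: "\<pi> permutes N" "\<And>S. S \<subseteq> N \<Longrightarrow> card S = k + 1 \<Longrightarrow> t S = \<pi> ` S" by simp_all
    have "s I = \<pi> ` I" if I: "I \<subseteq> N" "card I = k" for I
    proof -
      have "card (N - I) = card N - k" using I fin by (simp add: card_Diff_subset)
      then have "\<not> card (N - I) \<le> Suc 0" using k by simp
      then obtain x y where xy: "x \<in> N - I" "y \<in> N - I" "x \<noteq> y"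
        using \<open>finite N\<close> by (auto simp: card_le_Suc0_iff_eq)
      have "s I \<subseteq> \<pi> ` insert z I" if "z \<in> N - I" for z
      proof -
        have "insert z I \<subseteq> N" "card (insert z I) = k + 1" using I that fin[OF I(1)] by auto
        then show ?thesis using sub_t[of "insert z I" I] \<pi>(2)[of "insert z I"] I(2) by auto
      qed
      then have "s I \<subseteq> \<pi> ` insert x I \<inter> \<pi> ` insert y I" using xy by blast
      also have "\<dots> = \<pi> ` I" using xy permutes_inj[OF \<pi>(1)] by (auto dest: injD)
      finally show ?thesis
        using I s[OF I] fin permutes_inj_on[OF \<pi>(1)] by (intro card_subset_eq) (auto simp: card_image)
    qed
    with \<pi>(1) show ?thesis by (intro exI[of _ \<pi>]) simp
  qed
qed

section \<open>Simplices in the support of a relation\<close>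

text \<open>
  If some facet of \<open>I j\<close> were contained in no other simplex, the configuration that isolates this
  facet would leave the single nonzero term \<open>c j * simplex_volume m P (I j)\<close> of the relation.
\<close>
lemma relation_support_clique:
  fixes c :: "nat \<Rightarrow> 'a::field"
  assumes I: "\<And>j. j < m + 2 \<Longrightarrow> I j \<in> index_tuples m n"
    and inj: "inj_on (\<lambda>j. set (I j)) {..<m + 2}" and m: "m > 0"
    and c: "\<And>j. j < m + 2 \<Longrightarrow> c j \<noteq> 0"
    and relation: "\<And>P. P \<in> configurations m n \<Longrightarrow> (\<Sum>j<m + 2. c j * simplex_volume m P (I j)) = 0"
  shows "card (\<Union>j<m + 2. set (I j)) = m + 2"
proof -
  let ?X = "(\<lambda>j. set (I j)) ` {..<m + 2}"
  have I': "distinct (I j)" "length (I j) = m + 1" if "j < m + 2" for j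
    using I[OF that] by (auto simp: index_tuples_def strict_sorted_iff)
  have "finite (\<Union>?X) \<and> card (\<Union>?X) = (m + 1) + 1"
  proof (rule clique_of_facet_sharing)
    show "card ?X = (m + 1) + 1" using inj by (simp add: card_image)
    show "m + 1 \<ge> 2" using m by simp
    show "finite A \<and> card A = m + 1" if "A \<in> ?X" for A
      using that I' by (auto simp: distinct_card)
    show "\<exists>B\<in>?X. B \<noteq> A \<and> A - {a} \<subseteq> B" if "A \<in> ?X" "a \<in> A" for A a
    proof (rule ccontr)
      assume none: "\<not> (\<exists>B\<in>?X. B \<noteq> A \<and> A - {a} \<subseteq> B)"
      obtain j where j: "j < m + 2" "A = set (I j)" using \<open>A \<in> ?X\<close> by auto
      define js where "js = remove1 a (I j)"
      have js: "distinct js" "length js = m" "set js = A - {a}"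
        using I'[OF j(1)] \<open>a \<in> A\<close> j(2) by (auto simp: js_def length_remove1)
      let ?v = "\<lambda>k. simplex_volume m (facet_config js) (I k) :: 'a"
      have v_iff: "?v k \<noteq> 0 \<longleftrightarrow> k = j" if k: "k < m + 2" for k
      proof -
        have "?v k \<noteq> 0 \<longleftrightarrow> A - {a} \<subseteq> set (I k)"
          using simplex_volume_facet_config_nonzero_iff[OF js(1,2) I'[OF k], where 'a = 'a] js(3) by simp
        also have "\<dots> \<longleftrightarrow> set (I k) = A" using none k j by blast
        also have "\<dots> \<longleftrightarrow> k = j" using inj_onD[OF inj, of k j] j k by auto
        finally show ?thesis .
      qed
      have "(\<Sum>k<m + 2. c k * ?v k) = (\<Sum>k\<in>{j}. c k * ?v k)"
        using v_iff j by (intro sum.mono_neutral_right) auto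
      also have "\<dots> \<noteq> 0" using v_iff c j by simp
      finally show False using relation facet_config_in_configurations[OF js(2)] by blast
    qed
  qed
  then show ?thesis by (simp add: Union_eq UNION_eq)
qed

section \<open>Signed volumes determine the configuration up to an affine map\<close>

lemma inverse_of_nonzero_det:
  fixes A :: "'a::field mat"
  assumes "A \<in> carrier_mat m m" "det A \<noteq> 0"
  obtains B where "B \<in> carrier_mat m m" "A * B = 1\<^sub>m m" "B * A = 1\<^sub>m m"
  using det_non_zero_imp_unit[OF assms, of "()"] by (auto simp: Units_def ring_mat_simps)

text \<open>
  Replacing a vertex other than the base point by a new point multiplies the volume by a coordinate of
  the new point, up to a sign that depends only on the position of the vertex: the new point is
  listed last here, whereas Cramer's rule keeps it in the place of the vertex that it replaces.
\<close>
lemma simplex_volume_Cramer: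
  assumes k: "k < m"
  shows "\<exists>\<tau> :: 'a::idom. (\<tau> = 1 \<or> \<tau> = - 1) \<and> (\<forall>P w. w \<in> carrier_vec m \<longrightarrow>
    P l - P 0 = mat_of_cols m (map (\<lambda>i. P i - P 0) [1..<m + 1]) *\<^sub>v w \<longrightarrow>
    simplex_volume m P (delete_nth (k + 1) ([0..<m + 1] @ [l])) =
      \<tau> * (w $ k * simplex_volume m P [0..<m + 1]))"
proof -
  note upt_Suc [simp del]
  let ?xs = "[1..<m + 1]"
  have len: "length ?xs = m" by simp
  have "delete_nth k (?xs @ [l]) = take k ?xs @ drop (Suc k) ?xs @ [l]"
    using k by (simp add: delete_nth_def)
  moreover have "?xs[k := l] = take k ?xs @ l # drop (Suc k) ?xs"
    using k by (intro upd_conv_take_nth_drop) simp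
  ultimately have "mset (delete_nth k (?xs @ [l])) = mset (?xs[k := l])"
    by (simp only: mset_append mset.simps union_mset_add_mset_right add_0_right)
  then obtain \<tau> :: 'a where \<tau>: "\<tau> = 1 \<or> \<tau> = - 1"
    "\<And>f. det (mat_of_cols m (map f (delete_nth k (?xs @ [l])))) =
          \<tau> * det (mat_of_cols m (map f (?xs[k := l])))"
    using det_mat_of_cols_reorder[of "delete_nth k (?xs @ [l])" "?xs[k := l]", where 'a = 'a] k len
    by auto
  have upt: "[0..<m + 1] = 0 # ?xs" by (simp add: upt_conv_Cons)
  have "simplex_volume m P (delete_nth (k + 1) ([0..<m + 1] @ [l])) =
      \<tau> * (w $ k * simplex_volume m P [0..<m + 1])"
    if w: "w \<in> carrier_vec m" and
      eq: "P l - P 0 = mat_of_cols m (map (\<lambda>i. P i - P 0) ?xs) *\<^sub>v w" for P w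
  proof -
    let ?f = "\<lambda>i. P i - P 0"
    let ?N = "mat_of_cols m (map ?f ?xs)"
    have N: "?N \<in> carrier_mat m m" using len by (metis length_map mat_of_cols_carrier(1))
    have rep: "replace_col ?N (?f l) k = mat_of_cols m (map ?f (?xs[k := l]))"
      by (intro eq_matI) (auto simp: replace_col_def mat_of_cols_index nth_list_update)
    have "simplex_volume m P (delete_nth (k + 1) ([0..<m + 1] @ [l])) =
        det (mat_of_cols m (map ?f (delete_nth k (?xs @ [l]))))"
      unfolding upt by (simp add: simplex_volume_def delete_nth_def)
    also have "\<dots> = \<tau> * det (replace_col ?N (?f l) k)" unfolding rep by (rule \<tau>(2))
    also have "\<dots> = \<tau> * (w $ k * det ?N)"
      unfolding eq using cramer_lemma_mat[OF N w k] by simp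
    also have "det ?N = simplex_volume m P [0..<m + 1]"
      unfolding upt by (simp add: simplex_volume_def)
    finally show ?thesis .
  qed
  with \<tau>(1) show ?thesis by (intro exI[of _ \<tau>] conjI allI impI)
qed

text \<open>
  The matrix \<open>A\<close> is the linear part of the affine map between the first simplices of \<open>P\<close> and \<open>Q\<close>; its
  determinant is the quotient \<open>\<epsilon>\<close> of their volumes. The coordinates of another point are quotients of
  volumes, in which the common factor \<open>\<epsilon>\<close> cancels, so they are the same for \<open>P\<close> and \<open>Q\<close>.
\<close>
lemma affine_equivalence_of_equal_volumes:
  fixes P Q :: "nat \<Rightarrow> 'a::field vec"
  assumes mn: "m < n"
    and P: "\<And>i. i < n \<Longrightarrow> P i \<in> carrier_vec m" and Q: "\<And>i. i < n \<Longrightarrow> Q i \<in> carrier_vec m"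
    and \<epsilon>: "\<epsilon> = 1 \<or> \<epsilon> = - 1"
    and nondegenerate: "simplex_volume m P [0..<m + 1] \<noteq> 0"
    and base: "simplex_volume m Q [0..<m + 1] = \<epsilon> * simplex_volume m P [0..<m + 1]"
    and other: "\<And>l k. m < l \<Longrightarrow> l < n \<Longrightarrow> k < m \<Longrightarrow>
      simplex_volume m Q (delete_nth (k + 1) ([0..<m + 1] @ [l])) =
        \<epsilon> * simplex_volume m P (delete_nth (k + 1) ([0..<m + 1] @ [l]))"
  shows "\<exists>A v. A \<in> carrier_mat m m \<and> invertible_mat A \<and> (det A = 1 \<or> det A = - 1) \<and>
    v \<in> carrier_vec m \<and> (\<forall>i<n. Q i = A *\<^sub>v (P i + v))"
proof -
  note upt_Suc [simp del]
  let ?N = "\<lambda>R :: nat \<Rightarrow> 'a vec. mat_of_cols m (map (\<lambda>i. R i - R 0) [1..<m + 1])"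
  have N: "?N R \<in> carrier_mat m m" for R
    using mat_of_cols_carrier(1)[of m "map (\<lambda>i. R i - R 0) [1..<m + 1]"] by simp
  have upt: "[0..<m + 1] = 0 # [1..<m + 1]" by (simp add: upt_conv_Cons)
  have vol_N: "simplex_volume m R [0..<m + 1] = det (?N R)" for R
    unfolding upt by (simp add: simplex_volume_def)
  have "\<epsilon> \<noteq> 0" using \<epsilon> by auto
  have det_P: "det (?N P) \<noteq> 0" and det_Q: "det (?N Q) = \<epsilon> * det (?N P)"
    using nondegenerate base vol_N by auto
  obtain BP where BP: "BP \<in> carrier_mat m m" "?N P * BP = 1\<^sub>m m" "BP * ?N P = 1\<^sub>m m"
    using inverse_of_nonzero_det[OF N det_P] by blast
  obtain BQ where BQ: "BQ \<in> carrier_mat m m" "?N Q * BQ = 1\<^sub>m m"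
    using inverse_of_nonzero_det[OF N[of Q]] det_Q det_P \<open>\<epsilon> \<noteq> 0\<close> by auto
  define A where "A = ?N Q * BP"
  have A: "A \<in> carrier_mat m m" unfolding A_def by (rule mult_carrier_mat[OF N BP(1)])
  have "A * ?N P = ?N Q * (BP * ?N P)" unfolding A_def by (rule assoc_mult_mat[OF N BP(1) N])
  then have AN: "A * ?N P = ?N Q" using BP(3) right_mult_one_mat[OF N] by simp
  have "det A * det (?N P) = \<epsilon> * det (?N P)" using det_mult[OF A N[of P]] unfolding AN det_Q by (rule sym)
  then have det_A: "det A = \<epsilon>" using det_P by simp
  obtain B where B: "B \<in> carrier_mat m m" "A * B = 1\<^sub>m m" "B * A = 1\<^sub>m m"
    using inverse_of_nonzero_det[OF A] det_A \<open>\<epsilon> \<noteq> 0\<close> by blast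
  have "invertible_mat A"
    using A B unfolding invertible_mat_def inverts_mat_def by auto
  have P0: "P 0 \<in> carrier_vec m" and Q0: "Q 0 \<in> carrier_vec m" using P Q mn by auto
  have linear: "A *\<^sub>v (P i - P 0) = Q i - Q 0" if i: "i < n" for i
  proof -
    have "\<exists>w. w \<in> carrier_vec m \<and> P i - P 0 = ?N P *\<^sub>v w \<and> Q i - Q 0 = ?N Q *\<^sub>v w"
    proof -
      consider "i = 0" | "i \<noteq> 0" "i \<le> m" | "i > m" by linarith
      then show ?thesis
      proof cases
        case 1
        have "?N R *\<^sub>v 0\<^sub>v m = 0\<^sub>v m" for R using N[of R] by (intro eq_vecI) auto
        then show ?thesis using 1 P0 Q0 by (intro exI[of _ "0\<^sub>v m"]) auto
      next
        case 2
        have "R i - R 0 = ?N R *\<^sub>v unit_vec m (i - 1)" if "R i \<in> carrier_vec m" "R 0 \<in> carrier_vec m" for R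
        proof -
          have "?N R *\<^sub>v unit_vec m (i - 1) = ?N R *\<^sub>v col (1\<^sub>m m) (i - 1)"
            using 2 by simp
          also have "\<dots> = col (?N R * 1\<^sub>m m) (i - 1)"
            using 2 by (intro col_mult2[OF N, symmetric]) auto
          also have "?N R * 1\<^sub>m m = ?N R" by (rule right_mult_one_mat[OF N])
          also have "col (?N R) (i - 1) = map (\<lambda>i. R i - R 0) [1..<m + 1] ! (i - 1)"
            using 2 that by (intro col_mat_of_cols) auto
          finally show ?thesis using 2 by simp
        qed
        then show ?thesis using P Q P0 Q0 i by (intro exI[of _ "unit_vec m (i - 1)"]) auto
      next
        case 3
        define w where "w = BP *\<^sub>v (P i - P 0)"
        define w' where "w' = BQ *\<^sub>v (Q i - Q 0)"
        have w: "w \<in> carrier_vec m" "w' \<in> carrier_vec m"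
          unfolding w_def w'_def using BP BQ P Q P0 Q0 i by auto
        have eq_P: "P i - P 0 = ?N P *\<^sub>v w"
          unfolding w_def using BP P P0 i N
          by (metis assoc_mult_mat_vec minus_carrier_vec one_mult_mat_vec)
        have eq_Q: "Q i - Q 0 = ?N Q *\<^sub>v w'"
          unfolding w'_def using BQ Q Q0 i N
          by (metis assoc_mult_mat_vec minus_carrier_vec one_mult_mat_vec)
        have "w $ k = w' $ k" if k: "k < m" for k
        proof -
          obtain \<tau> :: 'a where \<tau>: "\<tau> = 1 \<or> \<tau> = - 1" and "\<forall>P w. w \<in> carrier_vec m \<longrightarrow>
            P i - P 0 = ?N P *\<^sub>v w \<longrightarrow>
            simplex_volume m P (delete_nth (k + 1) ([0..<m + 1] @ [i])) =
              \<tau> * (w $ k * simplex_volume m P [0..<m + 1])"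
            using simplex_volume_Cramer[OF k, of i, where 'a = 'a] by blast
          then have "\<tau> * (w' $ k * (\<epsilon> * det (?N P))) = \<epsilon> * (\<tau> * (w $ k * det (?N P)))"
            using other[OF 3 i k] w eq_P eq_Q vol_N det_Q by metis
          moreover have "\<tau> \<noteq> 0" using \<tau> by auto
          ultimately show ?thesis using det_P \<open>\<epsilon> \<noteq> 0\<close> by simp
        qed
        then have "w = w'" using w by (intro eq_vecI) auto
        with w eq_P eq_Q show ?thesis by blast
      qed
    qed
    then show ?thesis using assoc_mult_mat_vec[OF A N] AN by metis
  qed
  define v where "v = B *\<^sub>v Q 0 - P 0"
  have v: "v \<in> carrier_vec m" unfolding v_def using B Q0 P0 by simp
  have "Q i = A *\<^sub>v (P i + v)" if i: "i < n" for i
  proof -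
    have "P i + v = (P i - P 0) + B *\<^sub>v Q 0"
      unfolding v_def using P[OF i] P0 B(1) by (intro eq_vecI) auto
    then have "A *\<^sub>v (P i + v) = A *\<^sub>v (P i - P 0) + A *\<^sub>v (B *\<^sub>v Q 0)"
      using mult_add_distrib_mat_vec[OF A, of "P i - P 0" "B *\<^sub>v Q 0"] P[OF i] P0 B(1) Q0 by simp
    also have "A *\<^sub>v (B *\<^sub>v Q 0) = Q 0"
      using assoc_mult_mat_vec[OF A B(1) Q0] B(2) Q0 by simp
    also have "A *\<^sub>v (P i - P 0) + Q 0 = Q i"
      using linear[OF i] Q[OF i] Q0 by (intro eq_vecI) auto
    finally show ?thesis by simp
  qed
  with A \<open>invertible_mat A\<close> det_A \<epsilon> v show ?thesis by blast
qed

section \<open>Permutations of the volumes\<close>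

lemma index_tuplesD:
  assumes "is \<in> index_tuples m n"
  shows "distinct is" "length is = m + 1" "set is \<subseteq> {..<n}" "card (set is) = m + 1"
    "sorted_list_of_set (set is) = is"
  using assms unfolding index_tuples_def
  by (auto simp: strict_sorted_iff distinct_card sorted_list_of_set.idem_if_sorted_distinct)

lemma sorted_list_in_index_tuples:
  assumes "I \<subseteq> {..<n}" "card I = m + 1"
  shows "sorted_list_of_set I \<in> index_tuples m n"
  using assms finite_subset[OF assms(1)] by (auto simp: index_tuples_def)

lemma finite_index_tuples: "finite (index_tuples m n)"
proof (rule finite_subset)
  show "index_tuples m n \<subseteq> {is. set is \<subseteq> {..<n} \<and> length is = m + 1}" by (auto simp: index_tuples_def)
qed (simp add: finite_lists_length_eq)

lemma delete_nth_in_index_tuples: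
  assumes "S \<in> index_tuples (m + 1) n" "j < m + 2"
  shows "delete_nth j S \<in> index_tuples m n"
proof -
  note S = index_tuplesD[OF assms(1)]
  have "sorted_wrt (<) (take j S @ S ! j # drop (Suc j) S)"
    using assms S by (simp add: id_take_nth_drop[symmetric] index_tuples_def)
  then have "sorted_wrt (<) (delete_nth j S)" by (auto simp: delete_nth_def sorted_wrt_append)
  moreover have "set (delete_nth j S) \<subseteq> {..<n}" using S assms(2) by (auto simp: set_delete_nth)
  ultimately show ?thesis using S(2) assms(2) by (simp add: index_tuples_def length_delete_nth)
qed

text \<open>
  The volume polynomial determines the multiset of its roots, the squared volumes, and the square of
  a field element determines the element up to sign. The signs are taken extensional, so that there
  are only finitely many sign functions.
\<close>
lemma permutation_of_equal_volume_poly: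
  fixes P Q :: "nat \<Rightarrow> 'a::field vec"
  assumes "volume_poly m n Q = volume_poly m n P"
  shows "\<exists>\<sigma> \<epsilon>. \<sigma> permutes index_tuples m n \<and> \<epsilon> \<in> index_tuples m n \<rightarrow>\<^sub>E {1, - 1} \<and>
    (\<forall>is \<in> index_tuples m n. simplex_volume m Q is = \<epsilon> is * simplex_volume m P (\<sigma> is))"
proof -
  let ?T = "index_tuples m n"
  have "proots (volume_poly m n R) = image_mset (\<lambda>is. (simplex_volume m R is)\<^sup>2) (mset_set ?T)"
    for R :: "nat \<Rightarrow> 'a vec"
    unfolding volume_poly_def by (subst proots_prod) (simp_all add: sum_unfold_sum_mset)
  then have "image_mset (\<lambda>is. (simplex_volume m Q is)\<^sup>2) (mset_set ?T) =
      image_mset (\<lambda>is. (simplex_volume m P is)\<^sup>2) (mset_set ?T)"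
    using assms by metis
  then obtain \<sigma> where \<sigma>: "\<sigma> permutes ?T"
    "\<forall>is\<in>?T. (simplex_volume m Q is)\<^sup>2 = (simplex_volume m P (\<sigma> is))\<^sup>2"
    using image_mset_eq_implies_permutes[OF finite_index_tuples] by blast
  define \<epsilon> where "\<epsilon> = (\<lambda>is\<in>?T.
    if simplex_volume m Q is = simplex_volume m P (\<sigma> is) then 1 else - 1 :: 'a)"
  have "\<epsilon> \<in> ?T \<rightarrow>\<^sub>E {1, - 1}" by (auto simp: \<epsilon>_def)
  moreover have "\<forall>is\<in>?T. simplex_volume m Q is = \<epsilon> is * simplex_volume m P (\<sigma> is)"
    using \<sigma>(2) by (auto simp: \<epsilon>_def power2_eq_iff)
  ultimately show ?thesis using \<sigma>(1) by (intro exI[of _ \<sigma>] exI[of _ \<epsilon>] conjI)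
qed

text \<open>
  The relation for \<open>S\<close> between the volumes of \<open>Q\<close>, after substituting \<open>\<epsilon>\<^sub>I a\<^bsub>\<sigma> I\<^esub>(P)\<close> for the volume
  \<open>a\<^sub>I(Q)\<close>.
\<close>
definition permuted_relation ::
  "nat \<Rightarrow> (nat list \<Rightarrow> nat list) \<Rightarrow> (nat list \<Rightarrow> 'a) \<Rightarrow> nat list \<Rightarrow> (nat \<Rightarrow> 'a::comm_ring_1 vec) \<Rightarrow> 'a" where
  "permuted_relation m \<sigma> \<epsilon> S P =
     (\<Sum>j<m + 2. (- 1) ^ j * (\<epsilon> (delete_nth j S) * simplex_volume m P (\<sigma> (delete_nth j S))))"

lemma poly_function_permuted_relation:
  assumes "\<sigma> permutes index_tuples m n" "S \<in> index_tuples (m + 1) n"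
  shows "poly_function m n (permuted_relation m \<sigma> \<epsilon> S)"
proof -
  have "set (\<sigma> (delete_nth j S)) \<subseteq> {..<n}" "length (\<sigma> (delete_nth j S)) = m + 1" if "j < m + 2" for j
  proof -
    have "\<sigma> (delete_nth j S) \<in> index_tuples m n"
      using permutes_in_image[OF assms(1)] delete_nth_in_index_tuples[OF assms(2) that] by blast
    then show "set (\<sigma> (delete_nth j S)) \<subseteq> {..<n}" "length (\<sigma> (delete_nth j S)) = m + 1"
      by (simp_all add: index_tuplesD)
  qed
  then show ?thesis
    unfolding permuted_relation_def[abs_def]
    by (intro poly_function_sum poly_function_mult poly_function_const poly_function_simplex_volume)
      auto
qed

text \<open>
  By \<open>relation_support_clique\<close> the permutation maps the simplices in a set of \<open>m + 2\<close> points to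
  the simplices in another such set. For \<open>n = m + 1\<close> there is only one simplex and any
  permutation of the points will do.
\<close>
lemma volume_permutation_induced_by_points:
  fixes \<epsilon> :: "nat list \<Rightarrow> 'a::field"
  assumes mn: "0 < m" "m < n"
    and \<sigma>: "\<sigma> permutes index_tuples m n"
    and \<epsilon>: "\<epsilon> \<in> index_tuples m n \<rightarrow> {1, - 1}"
    and relations: "\<And>S P. S \<in> index_tuples (m + 1) n \<Longrightarrow> P \<in> configurations m n \<Longrightarrow>
      permuted_relation m \<sigma> \<epsilon> S P = 0"
  shows "\<exists>\<pi>. \<pi> permutes {..<n} \<and> (\<forall>is \<in> index_tuples m n. set (\<sigma> is) = \<pi> ` set is)"
proof (cases "m + 1 = n")
  case True
  have full: "set is = {..<n}" if "is \<in> index_tuples m n" for "is"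
    using index_tuplesD[OF that] True by (intro card_subset_eq) auto
  have "set (\<sigma> is) = id ` set is" if "is \<in> index_tuples m n" for "is"
    using that full permutes_in_image[OF \<sigma>, of "is"] by simp
  then show ?thesis using permutes_id by blast
next
  case False
  let ?T = "index_tuples m n"
  let ?s = "\<lambda>I. set (\<sigma> (sorted_list_of_set I))"
  have \<sigma>_in: "\<sigma> is \<in> ?T" if "is \<in> ?T" for "is" using that permutes_in_image[OF \<sigma>] by blast
  have \<sigma>_inj: "is = js" if "is \<in> ?T" "js \<in> ?T" "set (\<sigma> is) = set (\<sigma> js)" for "is" js
  proof -
    have "\<sigma> is = \<sigma> js" using index_tuplesD(5)[OF \<sigma>_in] that by metis
    then show ?thesis using permutes_inj[OF \<sigma>] by (auto dest: injD)
  qed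
  have "\<exists>\<pi>. \<pi> permutes {..<n} \<and> (\<forall>I. I \<subseteq> {..<n} \<and> card I = m + 1 \<longrightarrow> ?s I = \<pi> ` I)"
  proof (rule k_subset_map_induced_by_permutation)
    show "?s I \<subseteq> {..<n} \<and> card (?s I) = m + 1" if "I \<subseteq> {..<n}" "card I = m + 1" for I
      using index_tuplesD[OF \<sigma>_in[OF sorted_list_in_index_tuples[OF that]]] by blast
    show "inj_on ?s {I. I \<subseteq> {..<n} \<and> card I = m + 1}"
    proof (rule inj_onI)
      fix I J assume "I \<in> {I. I \<subseteq> {..<n} \<and> card I = m + 1}" "J \<in> {I. I \<subseteq> {..<n} \<and> card I = m + 1}"
        and eq: "?s I = ?s J"
      then have I: "I \<subseteq> {..<n}" "card I = m + 1" and J: "J \<subseteq> {..<n}" "card J = m + 1" by auto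
      have "sorted_list_of_set I = sorted_list_of_set J"
        by (rule \<sigma>_inj[OF sorted_list_in_index_tuples[OF I] sorted_list_in_index_tuples[OF J] eq])
      then show "I = J"
        using I J finite_subset[of _ "{..<n}"] by (metis finite_lessThan set_sorted_list_of_set)
    qed
    show "\<exists>S'. S' \<subseteq> {..<n} \<and> card S' = m + 1 + 1 \<and> (\<forall>I. I \<subseteq> S \<and> card I = m + 1 \<longrightarrow> ?s I \<subseteq> S')"
      if S: "S \<subseteq> {..<n}" "card S = m + 1 + 1" for S
    proof -
      define L where "L = sorted_list_of_set S"
      have L: "L \<in> index_tuples (m + 1) n"
        unfolding L_def using S by (intro sorted_list_in_index_tuples) auto
      have set_L: "set L = S" unfolding L_def using S finite_subset[OF S(1)] by simp
      let ?I = "\<lambda>j. \<sigma> (delete_nth j L)"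
      have del: "delete_nth j L \<in> ?T" "set (delete_nth j L) = S - {L ! j}" if "j < m + 2" for j
        using delete_nth_in_index_tuples[OF L that] set_delete_nth[of L j] index_tuplesD[OF L] that set_L
        by auto
      have "card (\<Union>j<m + 2. set (?I j)) = m + 2"
      proof (rule relation_support_clique)
        show "?I j \<in> ?T" if "j < m + 2" for j using \<sigma>_in del that by blast
        show "inj_on (\<lambda>j. set (?I j)) {..<m + 2}"
        proof (rule inj_onI)
          fix i j assume "i \<in> {..<m + 2}" "j \<in> {..<m + 2}" "set (?I i) = set (?I j)"
          then have ij: "i < m + 2" "j < m + 2" "delete_nth i L = delete_nth j L" using \<sigma>_inj del by auto
          then have "S - {L ! i} = S - {L ! j}" using del by metis
          moreover have "L ! i \<in> S" "L ! j \<in> S" using ij index_tuplesD(2)[OF L] set_L by auto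
          ultimately have "L ! i = L ! j" by blast
          then show "i = j" using ij index_tuplesD(1,2)[OF L] by (simp add: nth_eq_iff_index_eq)
        qed
        show "(- 1) ^ j * \<epsilon> (delete_nth j L) \<noteq> 0" if "j < m + 2" for j
          using funcset_mem[OF \<epsilon> del(1)[OF that]] by auto
        show "(\<Sum>j<m + 2. (- 1) ^ j * \<epsilon> (delete_nth j L) * simplex_volume m P (?I j)) = 0"
          if "P \<in> configurations m n" for P
          using relations[OF L that] by (simp add: permuted_relation_def mult.assoc)
      qed (rule mn)
      moreover have "(\<Union>j<m + 2. set (?I j)) \<subseteq> {..<n}"
        using index_tuplesD(3)[OF \<sigma>_in[OF del(1)]] by blast
      moreover have "?s I \<subseteq> (\<Union>j<m + 2. set (?I j))" if I: "I \<subseteq> S" "card I = m + 1" for I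
      proof -
        have "card (S - I) = 1" using I S finite_subset[OF I(1)] finite_subset[OF S(1)] by (simp add: card_Diff_subset)
        then obtain x where x: "S - I = {x}" by (auto simp: card_1_singleton_iff)
        then have "x \<in> set L" using set_L by blast
        then obtain j where j: "j < m + 2" "L ! j = x"
          using index_tuplesD(2)[OF L] by (auto simp: in_set_conv_nth)
        have "set (delete_nth j L) = I" using del(2)[OF j(1)] j(2) x I by blast
        then have "sorted_list_of_set I = delete_nth j L"
          using index_tuplesD(5)[OF del(1)[OF j(1)]] by simp
        then show ?thesis using j(1) by auto
      qed
      ultimately show ?thesis by (intro exI[of _ "\<Union>j<m + 2. set (?I j)"]) auto
    qed
  qed (use False mn in auto)
  then obtain \<pi> where \<pi>: "\<pi> permutes {..<n} \<and>
    (\<forall>I. I \<subseteq> {..<n} \<and> card I = m + 1 \<longrightarrow> ?s I = \<pi> ` I)" ..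
  have "set (\<sigma> is) = \<pi> ` set is" if "is \<in> ?T" for "is"
    using \<pi> index_tuplesD[OF that] by metis
  with \<pi> show ?thesis by (intro exI[of _ \<pi>]) simp
qed

lemma simplex_volume_comp:
  "is \<noteq> [] \<Longrightarrow> simplex_volume m P (map \<pi> is) = simplex_volume m (P \<circ> \<pi>) is"
  by (simp add: simplex_volume_def hd_map map_tl comp_def)

text \<open>
  With the points of \<open>P\<close> renumbered by \<open>\<pi>\<close>, the coefficients \<open>c\<^sub>I\<close> absorb both the signs \<open>\<epsilon>\<^sub>I\<close> and
  the signs \<open>\<tau>\<^sub>I\<close> that come from sorting the vertices of \<open>\<pi> I\<close>. The trivial relations,
  evaluated at configurations renumbered by the inverse of \<open>\<pi>\<close>, make \<open>c\<close> constant on the simplices of each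
  set of \<open>m + 2\<close> points; applied to the first simplex with one further point, this gives the
  common sign needed for the affine map.
\<close>
lemma reconstruction_from_trivial_relations:
  fixes P Q :: "nat \<Rightarrow> 'a::field vec"
  assumes mn: "0 < m" "m < n"
    and P: "P \<in> configurations m n" and Q: "Q \<in> configurations m n"
    and \<sigma>: "\<sigma> permutes index_tuples m n"
    and \<epsilon>: "\<epsilon> \<in> index_tuples m n \<rightarrow> {1, - 1}"
    and volumes: "\<And>is. is \<in> index_tuples m n \<Longrightarrow>
      simplex_volume m Q is = \<epsilon> is * simplex_volume m P (\<sigma> is)"
    and nondegenerate: "\<And>is. is \<in> index_tuples m n \<Longrightarrow> simplex_volume m P is \<noteq> 0"
    and relations: "\<And>S P. S \<in> index_tuples (m + 1) n \<Longrightarrow> P \<in> configurations m n \<Longrightarrow>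
      permuted_relation m \<sigma> \<epsilon> S P = 0"
  shows "\<exists>\<pi> A v. \<pi> permutes {..<n} \<and> A \<in> carrier_mat m m \<and> invertible_mat A \<and>
    (det A = 1 \<or> det A = - 1) \<and> v \<in> carrier_vec m \<and> (\<forall>i<n. Q i = A *\<^sub>v (P (\<pi> i) + v))"
proof -
  let ?T = "index_tuples m n"
  obtain \<pi> where \<pi>: "\<pi> permutes {..<n}" "\<And>is. is \<in> ?T \<Longrightarrow> set (\<sigma> is) = \<pi> ` set is"
    using volume_permutation_induced_by_points[OF mn \<sigma> \<epsilon> relations] by metis
  have \<sigma>_in: "\<sigma> is \<in> ?T" if "is \<in> ?T" for "is" using that permutes_in_image[OF \<sigma>] by blast
  have \<pi>_lt: "\<pi> i < n" "inv_into UNIV \<pi> i < n" if "i < n" for i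
    using permutes_in_image[OF \<pi>(1), of i] permutes_in_image[OF permutes_inv[OF \<pi>(1)], of i] that by auto
  have "\<exists>\<tau> :: 'a. (\<tau> = 1 \<or> \<tau> = - 1) \<and> (\<forall>R \<in> configurations m n.
      simplex_volume m R (\<sigma> is) = \<tau> * simplex_volume m (R \<circ> \<pi>) is)" if "is": "is \<in> ?T" for "is"
  proof -
    have "distinct (map \<pi> is)"
      using index_tuplesD(1)[OF "is"] permutes_inj_on[OF \<pi>(1)] by (simp add: distinct_map)
    then have "mset (\<sigma> is) = mset (map \<pi> is)"
      using \<pi>(2)[OF "is"] index_tuplesD(1)[OF \<sigma>_in[OF "is"]]
      by (subst set_eq_iff_mset_eq_distinct[symmetric]) auto
    moreover have "length (map \<pi> is) = m + 1" using index_tuplesD(2)[OF "is"] by simp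
    ultimately obtain \<tau> :: 'a where \<tau>: "\<tau> = 1 \<or> \<tau> = - 1"
      "\<forall>R. (\<forall>i\<in>set (map \<pi> is). R i \<in> carrier_vec m) \<longrightarrow>
        simplex_volume m R (\<sigma> is) = \<tau> * simplex_volume m R (map \<pi> is)"
      using simplex_volume_reorder[of "\<sigma> is" "map \<pi> is" m, where 'a = 'a] by auto
    have "simplex_volume m R (\<sigma> is) = \<tau> * simplex_volume m (R \<circ> \<pi>) is" if "R \<in> configurations m n" for R
    proof -
      have "\<forall>i\<in>set (map \<pi> is). R i \<in> carrier_vec m"
        using that index_tuplesD(3)[OF "is"] \<pi>_lt by (auto simp: configurations_def)
      moreover have "is \<noteq> []" using index_tuplesD(2)[OF "is"] by auto
      ultimately show ?thesis using \<tau>(2) by (simp add: simplex_volume_comp)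
    qed
    with \<tau>(1) show ?thesis by (intro exI[of _ \<tau>]) simp
  qed
  then obtain \<tau> where \<tau>: "\<And>is. is \<in> ?T \<Longrightarrow> \<tau> is = 1 \<or> \<tau> is = (- 1 :: 'a)"
    "\<And>is R. is \<in> ?T \<Longrightarrow> R \<in> configurations m n \<Longrightarrow>
      simplex_volume m R (\<sigma> is) = \<tau> is * simplex_volume m (R \<circ> \<pi>) is"
    by metis
  define c where "c is = \<epsilon> is * \<tau> is" for "is"
  have c: "c is = 1 \<or> c is = - 1" if "is \<in> ?T" for "is"
    using \<tau>(1)[OF that] funcset_mem[OF \<epsilon> that] by (auto simp: c_def)
  have Q_vol: "simplex_volume m Q is = c is * simplex_volume m (P \<circ> \<pi>) is" if "is \<in> ?T" for "is"
    using volumes[OF that] \<tau>(2)[OF that P] by (simp add: c_def)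
  have c_facets: "c (delete_nth i S) = c (delete_nth j S)"
    if S: "S \<in> index_tuples (m + 1) n" and ij: "i < m + 2" "j < m + 2" for S i j
  proof (rule relation_coefficients_constant[where c = "\<lambda>j. c (delete_nth j S)", OF _ _ _ ij])
    show "distinct S" "length S = m + 2" using index_tuplesD[OF S] by auto
    show "(\<Sum>j<m + 2. (- 1) ^ j * (c (delete_nth j S) * simplex_volume m R (delete_nth j S))) = 0"
      if R: "R \<in> configurations m n" for R
    proof -
      have R': "R \<circ> inv_into UNIV \<pi> \<in> configurations m n"
        using R \<pi>_lt by (auto simp: configurations_def)
      have "(R \<circ> inv_into UNIV \<pi>) \<circ> \<pi> = R"
        using permutes_inv_o(2)[OF \<pi>(1)] by (simp add: comp_assoc)
      then have "simplex_volume m (R \<circ> inv_into UNIV \<pi>) (\<sigma> (delete_nth j S)) =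
          \<tau> (delete_nth j S) * simplex_volume m R (delete_nth j S)" if "j < m + 2" for j
        using \<tau>(2)[OF delete_nth_in_index_tuples[OF S that] R'] by simp
      then have "permuted_relation m \<sigma> \<epsilon> S (R \<circ> inv_into UNIV \<pi>) =
          (\<Sum>j<m + 2. (- 1) ^ j * (c (delete_nth j S) * simplex_volume m R (delete_nth j S)))"
        unfolding permuted_relation_def c_def by (intro sum.cong) (auto simp: mult.assoc)
      then show ?thesis using relations[OF S R'] by simp
    qed
  qed
  let ?I = "[0..<m + 1]"
  note upt_Suc [simp del]
  have I: "?I \<in> ?T" using mn by (auto simp: index_tuples_def)
  have simplex: "?I @ [l] \<in> index_tuples (m + 1) n" if "m < l" "l < n" for l
    using that by (auto simp: index_tuples_def sorted_wrt_append)
  have last: "delete_nth (m + 1) (?I @ [l]) = ?I" for l by (simp add: delete_nth_def)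
  have "\<exists>A v. A \<in> carrier_mat m m \<and> invertible_mat A \<and> (det A = 1 \<or> det A = - 1) \<and>
    v \<in> carrier_vec m \<and> (\<forall>i<n. Q i = A *\<^sub>v ((P \<circ> \<pi>) i + v))"
  proof (rule affine_equivalence_of_equal_volumes[OF mn(2) _ _ c[OF I]])
    show "(P \<circ> \<pi>) i \<in> carrier_vec m" "Q i \<in> carrier_vec m" if "i < n" for i
      using P Q that \<pi>_lt by (auto simp: configurations_def)
    show "simplex_volume m (P \<circ> \<pi>) ?I \<noteq> 0"
      using nondegenerate[OF \<sigma>_in[OF I]] \<tau>(2)[OF I P] by auto
    show "simplex_volume m Q ?I = c ?I * simplex_volume m (P \<circ> \<pi>) ?I"
      by (rule Q_vol[OF I])
    show "simplex_volume m Q (delete_nth (k + 1) (?I @ [l])) =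
        c ?I * simplex_volume m (P \<circ> \<pi>) (delete_nth (k + 1) (?I @ [l]))"
      if l: "m < l" "l < n" and k: "k < m" for l k
      using Q_vol[OF delete_nth_in_index_tuples[OF simplex[OF l], of "k + 1"]]
        c_facets[OF simplex[OF l], of "k + 1" "m + 1"] k last by simp
  qed
  then show ?thesis using \<pi>(1) by auto
qed

theorem theorem2p7:
  fixes m n :: nat
  assumes "m > 0" and "n > m"
  shows "\<exists>f :: 'a::field config_poly. f \<in> config_poly_ring m n \<and> f \<noteq> 0 \<and>
           (\<forall>P \<in> configurations m n. config_poly_eval f P \<noteq> 0 \<longrightarrow>
              reconstructible_from_volumes m n P)"
proof -
  let ?T = "index_tuples m n" and ?C = "configurations m n :: (nat \<Rightarrow> 'a vec) set"
  define volumes where "volumes = (\<lambda>is P :: nat \<Rightarrow> 'a vec. simplex_volume m P is) ` ?T"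
  define relations where "relations = (\<lambda>(\<sigma>, \<epsilon> :: nat list \<Rightarrow> 'a, S). permuted_relation m \<sigma> \<epsilon> S) `
    ({\<sigma>. \<sigma> permutes ?T} \<times> (?T \<rightarrow>\<^sub>E {1, - 1}) \<times> index_tuples (m + 1) n)"
  define X where "X = volumes \<union> {F \<in> relations. \<exists>P \<in> ?C. F P \<noteq> 0}"
  have "\<exists>f \<in> config_poly_ring m n. f \<noteq> 0 \<and>
    (\<forall>P \<in> ?C. config_poly_eval f P \<noteq> 0 \<longrightarrow> (\<forall>F\<in>X. F P \<noteq> 0))"
  proof (rule nonvanishing_locus_of_finite_family)
    have "finite relations" unfolding relations_def
      by (intro finite_imageI finite_cartesian_product finite_permutations finite_PiE finite_index_tuples) auto
    then show "finite X" unfolding X_def volumes_def using finite_index_tuples by auto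
    show "poly_function m n F" if "F \<in> X" for F
      using that unfolding X_def volumes_def relations_def
      by (auto intro!: poly_function_permuted_relation poly_function_simplex_volume dest: index_tuplesD)
    show "\<exists>P \<in> ?C. F P \<noteq> 0" if "F \<in> X" for F
    proof (cases "F \<in> volumes")
      case True
      then obtain "is" where F: "F = (\<lambda>P. simplex_volume m P is)" and "is": "is \<in> ?T"
        unfolding volumes_def by blast
      note is' = index_tuplesD[OF "is"]
      \<comment> \<open>A volume is nonzero at the configuration that isolates one of its own facets.\<close>
      have "simplex_volume m (facet_config (tl is)) is \<noteq> (0 :: 'a)"
        using is' by (subst simplex_volume_facet_config_nonzero_iff)
          (auto simp: distinct_tl dest: list.set_sel(2)[rotated])
      moreover have "facet_config (tl is) \<in> ?C"
        using is' by (intro facet_config_in_configurations) simp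
      ultimately show ?thesis unfolding F by blast
    qed (use that in \<open>auto simp: X_def\<close>)
  qed
  then obtain f :: "'a config_poly" where f: "f \<in> config_poly_ring m n" "f \<noteq> 0"
    "\<And>P F. P \<in> ?C \<Longrightarrow> config_poly_eval f P \<noteq> 0 \<Longrightarrow> F \<in> X \<Longrightarrow> F P \<noteq> 0" by blast
  have "reconstructible_from_volumes m n P" if P: "P \<in> ?C" and fP: "config_poly_eval f P \<noteq> 0" for P
    unfolding reconstructible_from_volumes_def
  proof (intro ballI impI)
    fix Q assume Q: "Q \<in> ?C" and eq: "volume_poly m n Q = volume_poly m n P"
    obtain \<sigma> \<epsilon> where \<sigma>: "\<sigma> permutes ?T" and \<epsilon>: "\<epsilon> \<in> ?T \<rightarrow>\<^sub>E {1, - 1}"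
      and vol: "\<And>is. is \<in> ?T \<Longrightarrow> simplex_volume m Q is = \<epsilon> is * simplex_volume m P (\<sigma> is)"
      using permutation_of_equal_volume_poly[OF eq] by blast
    show "\<exists>\<pi> A v. \<pi> permutes {..<n} \<and> A \<in> carrier_mat m m \<and> invertible_mat A \<and>
      (det A = 1 \<or> det A = - 1) \<and> v \<in> carrier_vec m \<and> (\<forall>i<n. Q i = A *\<^sub>v (P (\<pi> i) + v))"
    proof (rule reconstruction_from_trivial_relations[OF assms P Q \<sigma> _ vol])
      show "\<epsilon> \<in> ?T \<rightarrow> {1, - 1}" using \<epsilon> by (auto simp: PiE_def)
      show "simplex_volume m P is \<noteq> 0" if "is \<in> ?T" for "is"
        using f(3)[OF P fP, of "\<lambda>P. simplex_volume m P is"] that unfolding X_def volumes_def by blast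
      show "permuted_relation m \<sigma> \<epsilon> S R = 0" if S: "S \<in> index_tuples (m + 1) n" and R: "R \<in> ?C" for S R
      proof (rule ccontr)
        assume nz: "permuted_relation m \<sigma> \<epsilon> S R \<noteq> 0"
        have "permuted_relation m \<sigma> \<epsilon> S \<in> relations"
          unfolding relations_def using \<sigma> \<epsilon> S by force
        then have "permuted_relation m \<sigma> \<epsilon> S P \<noteq> 0"
          using f(3)[OF P fP] nz R unfolding X_def by blast
        moreover have "permuted_relation m \<sigma> \<epsilon> S P =
            (\<Sum>j<m + 2. (- 1) ^ j * simplex_volume m Q (delete_nth j S))"
          unfolding permuted_relation_def
          using vol delete_nth_in_index_tuples[OF S] by (intro sum.cong) auto
        moreover have "\<dots> = 0"
          using index_tuplesD[OF S] Q by (intro simplex_volume_cocycle) (auto simp: configurations_def)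
        ultimately show False by simp
      qed
    qed
  qed
  with f(1,2) show ?thesis by blast
qed

end
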